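(* Let $\zeta:A\to A^*$ be an expanding substitution on a finite alphabet $A$ and let $a_i\in A$ be a letter. Then there is a well-defined shift-invariant measure $\mu_{a_i}$ on the substitution subshift $\Sigma_\zeta$, determined as follows: after possibly replacing $\zeta$ by a suitable positive power $\zeta^s$ for which all the limits below exist, one has for any non-empty $w\in A^*$ $$\mu_{a_i}(\mathrm{Cyl}_w)=\lim_{t\to\infty}\frac{|\zeta^{t}(a_i)|_w}{|\zeta^{t}(a_i)|}.$$
   Context: A substitution $\zeta$ on a finite alphabet $A$ assigns to every letter $a_i\in A$ a word $\zeta(a_i)$ in the free monoid $A^*$ and extends to a monoid endomorphism of $A^*$. It is expanding if there is $k\ge 1$ with $|\zeta^k(a)|\ge 2$ for every $a\in A$. For $u\in A^*$, $|u|$ is its length and $|u|_w$ is the number of occurrences of $w$ as a factor (contiguous subword) of $u$. The language $\mathcal{L}_\zeta\subset A^*$ consists of all words that appear as a factor of $\zeta^k(a)$ for some $a\in A$ and some $k\ge 0$. The subshift $\Sigma_\zeta\subset A^{\mathbb{Z}}$ (product topology, shift operator shifting indices by $-1$) is the set of all biinfinite words all of whose finite factors belong to $\mathcal{L}_\zeta$. For $w=x_1\dots x_m\in A^*$ the cylinder $\mathrm{Cyl}_w\subset\Sigma_\zeta$ consists of all $\dots y_iy_{i+1}y_{i+2}\dots\in\Sigma_\zeta$ with $y_1=x_1,\dots,y_m=x_m$. Measures are (non-negative) Borel measures; it is a fact that for every expanding $\zeta$ some positive power $\zeta^s$ has the property that all the limits $\lim_{t\to\infty}|\zeta^{st}(a)|_w/|\zeta^{st}(a)|$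 (for $a\in A$, $w\in A^*$ non-empty) exist. *)

theory Defs
  imports "HOL-Analysis.Analysis" "HOL-Library.Sublist"
begin

text \<open>The alphabet is a finite type \<open>'a\<close>, the free monoid on it is \<open>'a list\<close>.\<close>

definition subst_ext :: "('a \<Rightarrow> 'a list) \<Rightarrow> 'a list \<Rightarrow> 'a list" where
  "subst_ext \<zeta> u = concat (map \<zeta> u)"

definition subst_iter :: "('a \<Rightarrow> 'a list) \<Rightarrow> nat \<Rightarrow> 'a \<Rightarrow> 'a list" where
  "subst_iter \<zeta> t a = (subst_ext \<zeta> ^^ t) [a]"

definition expanding :: "('a \<Rightarrow> 'a list) \<Rightarrow> bool" where
  "expanding \<zeta> \<longleftrightarrow> (\<exists>k\<ge>1. \<forall>a. length (subst_iter \<zeta> k a) \<ge> 2)"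

text \<open>Overlapping occurrences are counted separately.\<close>

definition occurrences :: "'a list \<Rightarrow> 'a list \<Rightarrow> nat" where
  "occurrences w u =
     card {i. i + length w \<le> length u \<and> take (length w) (drop i u) = w}"

definition subst_language :: "('a \<Rightarrow> 'a list) \<Rightarrow> 'a list set" where
  "subst_language \<zeta> = {u. \<exists>a k. sublist u (subst_iter \<zeta> k a)}"

definition biinf_factor :: "(int \<Rightarrow> 'a) \<Rightarrow> int \<Rightarrow> nat \<Rightarrow> 'a list" where
  "biinf_factor y i n = map (\<lambda>j. y (i + int j)) [0..<n]"

definition subst_subshift :: "('a \<Rightarrow> 'a list) \<Rightarrow> (int \<Rightarrow> 'a) set" where
  "subst_subshift \<zeta> = {y. \<forall>i n. biinf_factor y i n \<in> subst_language \<zeta>}"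

text \<open>A cylinder prescribes the letters at positions \<open>1, \<dots>, length w\<close>.\<close>

definition subst_cylinder :: "('a \<Rightarrow> 'a list) \<Rightarrow> 'a list \<Rightarrow> (int \<Rightarrow> 'a) set" where
  "subst_cylinder \<zeta> w = {y \<in> subst_subshift \<zeta>. biinf_factor y 1 (length w) = w}"

definition biinf_shift :: "(int \<Rightarrow> 'a) \<Rightarrow> int \<Rightarrow> 'a" where
  "biinf_shift y = (\<lambda>i. y (i + 1))"

definition subshift_topology :: "('a \<Rightarrow> 'a list) \<Rightarrow> (int \<Rightarrow> 'a) topology" where
  "subshift_topology \<zeta> =
     subtopology (product_topology (\<lambda>_. discrete_topology UNIV) UNIV) (subst_subshift \<zeta>)"

definition borel_measure_on :: "'b topology \<Rightarrow> 'b measure \<Rightarrow> bool" where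
  "borel_measure_on X \<mu> \<longleftrightarrow>
     space \<mu> = topspace X \<and> sets \<mu> = sigma_sets (topspace X) {U. openin X U}"

definition invariant_measure :: "('b \<Rightarrow> 'b) \<Rightarrow> 'b measure \<Rightarrow> bool" where
  "invariant_measure T \<mu> \<longleftrightarrow>
     T \<in> measurable \<mu> \<mu> \<and>
     (\<forall>B \<in> sets \<mu>. emeasure \<mu> (T -` B \<inter> space \<mu>) = emeasure \<mu> B)"

text \<open>The relative frequency of \<open>w\<close> in \<open>(\<zeta>\<^sup>s)\<^sup>t(a)\<close>; the index \<open>s\<close> realises the
  passage from \<open>\<zeta>\<close> to its power \<open>\<zeta>\<^sup>s\<close>.\<close>

definition subst_freq ::
    "('a \<Rightarrow> 'a list) \<Rightarrow> nat \<Rightarrow> 'a \<Rightarrow> 'a list \<Rightarrow> nat \<Rightarrow> real" where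
  "subst_freq \<zeta> s a w t =
     real (occurrences w (subst_iter \<zeta> (s * t) a)) / real (length (subst_iter \<zeta> (s * t) a))"

definition freqs_converge :: "('a \<Rightarrow> 'a list) \<Rightarrow> nat \<Rightarrow> 'a \<Rightarrow> bool" where
  "freqs_converge \<zeta> s a \<longleftrightarrow> (\<forall>w. w \<noteq> [] \<longrightarrow> convergent (subst_freq \<zeta> s a w))"

end

theory Submission
  imports Defs "HOL-Real_Asymp.Real_Asymp"
begin

text \<open>
  Let \<open>N b c\<close> be the number of occurrences of the letter \<open>c\<close> in \<open>\<zeta> b\<close>. The letter counts of the
  iterates of \<open>\<zeta>\<close> are the entries of the powers of \<open>N\<close>, and this matrix may be reducible and
  periodic. Periodicity is removed by passing to a power \<open>\<zeta> ^ s\<close> for which the relation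
  ``\<open>c\<close> occurs in the image of \<open>b\<close>'' is transitive (\<open>subst_power_transitive\<close>): a finite semigroup
  generated by one element contains an idempotent. Then letters that occur in the images of each
  other form strictly positive blocks, on which Perron--Frobenius theory gives purely exponential
  growth (\<open>positive_block_growth\<close>). Between the blocks counts propagate by convolution, and an
  induction along reachability shows that the vector of letter counts in the image of a letter
  under \<open>\<zeta> ^ (s * t)\<close>, divided by some \<open>(t + 1) ^ k * \<rho> ^ t\<close>, converges to a nonzero vector
  (\<open>transitive_matrix_growth\<close>). Hence the letter frequencies converge.

  Convergence for all words, with the same power \<open>s\<close>, follows from that for letters by expansion
  (\<open>word_frequency_converges\<close>): a high iterate is a concatenation of long images of letters, and
  the occurrences of a given word that straddle two of them are few in proportion to the length.

  The limit frequencies \<open>\<nu>\<close> are consistent in the sense of Kolmogorov on both sides, because an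
  occurrence fails to extend to the right or to the left at most once in any word. By compactness
  of the full shift and Caratheodory's theorem, such weights extend to a measure on biinfinite words
  that gives weight \<open>\<nu> w\<close> to the set of sequences showing \<open>w\<close> at any prescribed position
  (\<open>consistent_weights_extend\<close>). Words outside the language have frequency \<open>0\<close>, so this measure lives
  on the subshift, and since its values do not depend on the position, it is invariant
  (\<open>invariant_measure_of_weights\<close>). Conversely, invariance and the values on the cylinders at
  position \<open>1\<close> determine the measure of all cylinders and thus the measure
  (\<open>measure_eqI_window_cylinders\<close>). Finally, the prescribed values do not depend on the power:
  iterates of two admissible powers have a common subsequence.
\<close>

section \<open>Growth scales and convolutions\<close>

text \<open>The scale on which powers of a nonnegative matrix are measured. The base is
  \<open>Suc t\<close> and not \<open>t\<close>, so that the scale never vanishes and can be divided by.\<close>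

definition growth :: "nat \<Rightarrow> real \<Rightarrow> nat \<Rightarrow> real" where
  "growth k \<rho> t = real (Suc t) ^ k * \<rho> ^ t"

lemma growth_pos: "0 < \<rho> \<Longrightarrow> 0 < growth k \<rho> t"
  by (simp add: growth_def)

lemma growth_0: "growth 0 \<rho> t = \<rho> ^ t"
  by (simp add: growth_def)

lemma growth_lag_le:
  assumes "0 < \<rho>" "j \<le> t"
  shows "growth k \<rho> (t - j) / growth k \<rho> t \<le> 1 / \<rho> ^ j"
proof -
  have p: "\<rho> ^ t = \<rho> ^ (t - j) * \<rho> ^ j"
    using assms by (simp flip: power_add)
  have "real (Suc (t - j)) ^ k \<le> real (Suc t) ^ k"
    by (intro power_mono) auto
  then have "growth k \<rho> (t - j) * \<rho> ^ j \<le> growth k \<rho> t"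
    unfolding growth_def p using assms by (simp add: mult.assoc mult_right_mono)
  then show ?thesis
    using assms growth_pos[of \<rho> k t] by (simp add: field_simps)
qed

lemma growth_lag_lim:
  assumes "0 < \<rho>"
  shows "(\<lambda>t. growth k \<rho> (t - j) / growth k \<rho> t) \<longlonglongrightarrow> 1 / \<rho> ^ j"
proof -
  have "(\<lambda>t. real (Suc t) / real (Suc (t + j))) \<longlonglongrightarrow> 1"
    by real_asymp
  then have "(\<lambda>t. (real (Suc t) / real (Suc (t + j))) ^ k * (1 / \<rho> ^ j)) \<longlonglongrightarrow> 1 ^ k * (1 / \<rho> ^ j)"
    by (intro tendsto_intros)
  then have "(\<lambda>t. growth k \<rho> (t + j - j) / growth k \<rho> (t + j)) \<longlonglongrightarrow> 1 / \<rho> ^ j"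
    using assms by (simp add: growth_def power_divide power_add field_simps del: of_nat_Suc)
  then show ?thesis
    by (rule LIMSEQ_offset)
qed

lemma tendsto_growth_shift:
  assumes "0 < \<rho>" "(\<lambda>t. x (Suc t) / growth k \<rho> t) \<longlonglongrightarrow> L"
  shows "(\<lambda>t. x t / growth k \<rho> t) \<longlonglongrightarrow> L / \<rho>"
proof -
  have "(\<lambda>t. growth k \<rho> t / growth k \<rho> (Suc t)) \<longlonglongrightarrow> 1 / \<rho>"
    using LIMSEQ_Suc[OF growth_lag_lim[OF assms(1), of k 1]] by simp
  from tendsto_mult[OF assms(2) this]
  have "(\<lambda>t. x (Suc t) / growth k \<rho> (Suc t)) \<longlonglongrightarrow> L / \<rho>"
    using growth_pos[OF assms(1)] by (simp add: less_imp_neq[symmetric])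
  then show ?thesis by (rule LIMSEQ_imp_Suc)
qed

text \<open>The scales are totally ordered by the lexicographic order of \<open>(\<rho>, k)\<close>; this is what
  allows the fastest of finitely many growth rates to be picked out.\<close>

lemma growth_ratio_lim:
  assumes "0 < \<rho>" "0 < \<rho>'" and less: "\<rho> < \<rho>' \<or> \<rho> = \<rho>' \<and> k < k'"
  shows "(\<lambda>t. growth k \<rho> t / growth k' \<rho>' t) \<longlonglongrightarrow> 0"
proof (cases "\<rho> < \<rho>'")
  case True
  define q where "q = \<rho> / \<rho>'"
  have q: "0 < q" "q < 1" using True assms by (auto simp: q_def)
  have "(\<lambda>t. real t ^ k * q ^ t) \<longlonglongrightarrow> 0"
  proof (cases "k = 0")
    case True
    then show ?thesis using q by (simp add: LIMSEQ_power_zero)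
  next
    case False
    define r where "r = root k q"
    have r: "0 < r" "r < 1" "r ^ k = q"
      using q False by (auto simp: r_def)
    have "(\<lambda>t. (real t * r ^ t) ^ k) \<longlonglongrightarrow> 0 ^ k"
      by (intro tendsto_power powser_times_n_limit_0) (use r in auto)
    moreover have "(real t * r ^ t) ^ k = real t ^ k * q ^ t" for t
      by (simp add: power_mult_distrib mult.commute flip: r(3) power_mult)
    ultimately show ?thesis using False by (simp add: zero_power)
  qed
  then have "(\<lambda>t. real (Suc t) ^ k * q ^ Suc t / q) \<longlonglongrightarrow> 0 / q"
    by (intro tendsto_divide tendsto_const LIMSEQ_Suc) (use q in auto)
  then have lim: "(\<lambda>t. real (Suc t) ^ k * q ^ t) \<longlonglongrightarrow> 0"
    using q by simp
  have "norm (growth k \<rho> t / growth k' \<rho>' t) \<le> real (Suc t) ^ k * q ^ t" for t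
  proof -
    have "growth k \<rho> t / growth k' \<rho>' t = real (Suc t) ^ k * q ^ t / real (Suc t) ^ k'"
      by (simp add: growth_def q_def power_divide)
    also have "\<dots> \<le> real (Suc t) ^ k * q ^ t / 1"
      by (rule divide_left_mono) (use q in auto)
    finally show ?thesis
      using growth_pos[OF assms(1), of k t] growth_pos[OF assms(2), of k' t] by simp
  qed
  then show ?thesis
    by (intro Lim_null_comparison[OF always_eventually lim] allI)
next
  case False
  then have eq: "\<rho> = \<rho>'" "k < k'" using less by auto
  have "growth k \<rho> t / growth k' \<rho>' t = (1 / real (Suc t)) ^ (k' - k)" for t
  proof -
    have "real (Suc t) ^ k' = real (Suc t) ^ k * real (Suc t) ^ (k' - k)"
      using eq by (simp flip: power_add)
    then show ?thesis using eq assms by (simp add: growth_def power_divide)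
  qed
  moreover have "(\<lambda>t. (1 / real (Suc t)) ^ (k' - k)) \<longlonglongrightarrow> 0 ^ (k' - k)"
    by (intro tendsto_power) real_asymp
  ultimately show ?thesis using eq by (simp add: zero_power)
qed

lemma growth_summable:
  assumes "0 < \<rho>" "\<rho> < \<rho>'"
  shows "summable (\<lambda>t. growth k \<rho> t / \<rho>' ^ t)"
proof -
  define \<sigma> where "\<sigma> = (\<rho> + \<rho>') / 2"
  have \<sigma>: "\<rho> < \<sigma>" "\<sigma> < \<rho>'" "0 < \<sigma>" using assms by (auto simp: \<sigma>_def)
  have "(\<lambda>t. growth k \<rho> t / growth 0 \<sigma> t) \<longlonglongrightarrow> 0"
    using assms \<sigma> by (intro growth_ratio_lim) auto
  then have "\<forall>\<^sub>F t in sequentially. growth k \<rho> t / growth 0 \<sigma> t < 1"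
    by (rule order_tendstoD) simp
  then have "\<forall>\<^sub>F t in sequentially. norm (growth k \<rho> t / \<rho>' ^ t) \<le> (\<sigma> / \<rho>') ^ t"
  proof eventually_elim
    case (elim t)
    then have "growth k \<rho> t \<le> \<sigma> ^ t" using \<sigma> by (simp add: growth_0)
    then show ?case
      using growth_pos[OF assms(1), of k t] assms by (simp add: power_divide divide_right_mono)
  qed
  then show ?thesis
    by (rule summable_comparison_test_ev) (use \<sigma> assms in \<open>auto intro!: summable_geometric\<close>)
qed

lemma summable_of_slower_growth:
  fixes a :: "nat \<Rightarrow> real"
  assumes \<rho>: "0 < \<rho>" "\<rho> < \<rho>'" and a: "(\<lambda>t. a t / growth k \<rho> t) \<longlonglongrightarrow> \<alpha>"
  shows "summable (\<lambda>t. \<bar>a t\<bar> / \<rho>' ^ t)"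
proof -
  obtain B where B: "\<And>t. \<bar>a t / growth k \<rho> t\<bar> \<le> B"
    using convergent_imp_Bseq[OF convergentI[OF a]] by (auto simp: Bseq_def)
  have "norm (\<bar>a t\<bar> / \<rho>' ^ t) \<le> B * (growth k \<rho> t / \<rho>' ^ t)" for t
    using B[of t] growth_pos[OF \<rho>(1), of k t] \<rho> by (simp add: divide_le_eq divide_right_mono)
  then show ?thesis
    by (intro summable_comparison_test'[OF summable_mult[OF growth_summable[OF \<rho>]]])
qed

text \<open>If \<open>a\<close> is summable against the rate \<open>\<rho>\<close> of \<open>b\<close>, then \<open>b\<close> dictates the growth of the
  convolution: each term \<open>a j * b (t - j)\<close>, divided by the scale, tends to \<open>a j * \<beta> / \<rho> ^ j\<close>,
  and \<open>growth_lag_le\<close> supplies the summable bound required by Tannery's theorem.\<close>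

lemma convolution_slower:
  fixes a b :: "nat \<Rightarrow> real"
  assumes \<rho>: "0 < \<rho>" and a: "summable (\<lambda>j. \<bar>a j\<bar> / \<rho> ^ j)"
    and b: "(\<lambda>t. b t / growth k \<rho> t) \<longlonglongrightarrow> \<beta>"
  shows "convergent (\<lambda>t. (\<Sum>j\<le>t. a j * b (t - j)) / growth k \<rho> t)"
proof -
  define F where "F j t = (if j \<le> t then a j * b (t - j) / growth k \<rho> t else 0)" for j t
  obtain B where B: "\<And>t. \<bar>b t / growth k \<rho> t\<bar> \<le> B"
    using convergent_imp_Bseq[OF convergentI[OF b]] by (auto simp: Bseq_def)
  have B0: "0 \<le> B" using B[of 0] by linarith
  have gp: "\<And>t. 0 < growth k \<rho> t" by (rule growth_pos[OF \<rho>])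
  have F_eq: "F j t = a j * (b (t - j) / growth k \<rho> (t - j)) * (growth k \<rho> (t - j) / growth k \<rho> t)"
    if "j \<le> t" for j t
    using that gp[of "t - j"] by (simp add: F_def)
  have limF: "(\<lambda>t. F j t) \<longlonglongrightarrow> a j * \<beta> * (1 / \<rho> ^ j)" for j
  proof -
    have "(\<lambda>t. b (t - j) / growth k \<rho> (t - j)) \<longlonglongrightarrow> \<beta>"
      by (rule filterlim_compose[OF b]) (rule filterlim_minus_const_nat_at_top)
    then have "(\<lambda>t. a j * (b (t - j) / growth k \<rho> (t - j)) * (growth k \<rho> (t - j) / growth k \<rho> t))
        \<longlonglongrightarrow> a j * \<beta> * (1 / \<rho> ^ j)"
      by (intro tendsto_mult tendsto_const growth_lag_lim[OF \<rho>])
    then show ?thesis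
      by (rule Lim_transform_eventually)
        (auto simp: F_eq intro: eventually_mono[OF eventually_ge_at_top[of j]])
  qed
  have bound: "norm (F j t) \<le> \<bar>a j\<bar> / \<rho> ^ j * B" for j t
  proof (cases "j \<le> t")
    case True
    have "norm (F j t) = \<bar>a j\<bar> * \<bar>b (t - j) / growth k \<rho> (t - j)\<bar> * (growth k \<rho> (t - j) / growth k \<rho> t)"
      unfolding F_eq[OF True] using gp[of t] gp[of "t - j"] by (simp add: abs_mult)
    also have "\<dots> \<le> \<bar>a j\<bar> * B * (1 / \<rho> ^ j)"
      using gp[of t] gp[of "t - j"]
      by (intro mult_mono growth_lag_le[OF \<rho> True] B) (auto simp: B0 less_imp_le)
    finally show ?thesis by simp
  next
    case False
    then show ?thesis using B0 \<rho> by (simp add: F_def)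
  qed
  have "(\<lambda>t. suminf (\<lambda>j. F j t)) \<longlonglongrightarrow> suminf (\<lambda>j. a j * \<beta> * (1 / \<rho> ^ j))"
    using tannerys_theorem[of F "\<lambda>j. a j * \<beta> * (1 / \<rho> ^ j)" sequentially
        "\<lambda>j. \<bar>a j\<bar> / \<rho> ^ j * B"] limF bound summable_mult2[OF a, of B]
    by (auto intro!: always_eventually)
  moreover have "suminf (\<lambda>j. F j t) = (\<Sum>j\<le>t. a j * b (t - j)) / growth k \<rho> t" for t
  proof -
    have "suminf (\<lambda>j. F j t) = (\<Sum>j\<le>t. F j t)"
      by (rule suminf_finite) (auto simp: F_def)
    also have "\<dots> = (\<Sum>j\<le>t. a j * b (t - j)) / growth k \<rho> t"
      by (simp add: F_def sum_divide_distrib)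
    finally show ?thesis .
  qed
  ultimately show ?thesis
    by (auto simp: convergent_def)
qed

lemma average_null:
  fixes x :: "nat \<Rightarrow> real"
  assumes "x \<longlonglongrightarrow> L"
  shows "(\<lambda>t. (\<Sum>i\<le>t. \<bar>x i - L\<bar>) / real (Suc t)) \<longlonglongrightarrow> 0"
proof (rule LIMSEQ_I)
  fix e :: real assume e: "0 < e"
  obtain N where N: "\<And>i. i \<ge> N \<Longrightarrow> norm (x i - L) < e / 2"
    using LIMSEQ_D[OF assms, of "e / 2"] e by auto
  define C where "C = (\<Sum>i<N. \<bar>x i - L\<bar>)"
  have "(\<lambda>t. C / real (Suc t)) \<longlonglongrightarrow> 0" by real_asymp
  then obtain N' where N': "\<And>t. t \<ge> N' \<Longrightarrow> norm (C / real (Suc t) - 0) < e / 2"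
    using LIMSEQ_D[of "\<lambda>t. C / real (Suc t)" 0 "e / 2"] e by auto
  show "\<exists>no. \<forall>n\<ge>no. norm ((\<Sum>i\<le>n. \<bar>x i - L\<bar>) / real (Suc n) - 0) < e"
  proof (intro exI allI impI)
    fix t assume t: "N' \<le> t"
    have "(\<Sum>i\<le>t. \<bar>x i - L\<bar>) \<le> (\<Sum>i\<le>t. (if i < N then \<bar>x i - L\<bar> else 0) + e / 2)"
      using N e by (intro sum_mono) (auto simp: less_imp_le not_less)
    also have "\<dots> = (\<Sum>i\<le>t. if i < N then \<bar>x i - L\<bar> else 0) + real (Suc t) * (e / 2)"
      by (simp add: sum.distrib)
    also have "(\<Sum>i\<le>t. if i < N then \<bar>x i - L\<bar> else 0) = (\<Sum>i\<in>{..t} \<inter> {i. i < N}. \<bar>x i - L\<bar>)"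
      by (simp add: sum.inter_restrict)
    also have "\<dots> \<le> C"
      unfolding C_def by (rule sum_mono2) auto
    finally have "(\<Sum>i\<le>t. \<bar>x i - L\<bar>) / real (Suc t) \<le> (C + real (Suc t) * (e / 2)) / real (Suc t)"
      by (intro divide_right_mono) auto
    also have "\<dots> = C / real (Suc t) + e / 2"
      by (simp add: add_divide_distrib del: of_nat_Suc)
    also have "\<dots> < e" using N'[OF t] unfolding real_norm_def by linarith
    finally show "norm ((\<Sum>i\<le>t. \<bar>x i - L\<bar>) / real (Suc t) - 0) < e"
      by (simp add: sum_nonneg)
  qed
qed

text \<open>The increments of \<open>i ^ Suc d\<close> telescope, and their ratio to \<open>(i + 1) ^ d\<close> tends to
  \<open>d + 1\<close>; averaging that ratio gives the claim.\<close>

lemma power_sum_asymptotics: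
  "(\<lambda>t. (\<Sum>i\<le>t. real (Suc i) ^ d) / real (Suc t) ^ Suc d) \<longlonglongrightarrow> 1 / real (Suc d)"
proof -
  define x where "x i = (real (Suc i) ^ Suc d - real i ^ Suc d) / real (Suc i) ^ d" for i
  define A where "A t = (\<Sum>i\<le>t. \<bar>x i - real (Suc d)\<bar>) / real (Suc t)" for t
  have x_lim: "x \<longlonglongrightarrow> real (Suc d)"
  proof -
    have "((\<lambda>z::real. z ^ Suc d) has_real_derivative real (Suc d) * 1 ^ d) (at 1)"
      by (auto intro!: derivative_eq_intros)
    \<comment> \<open>the ratio is the difference quotient of \<open>z ^ Suc d\<close> at \<open>1\<close> with step \<open>- 1 / (i + 1)\<close>\<close>
    then have D: "((\<lambda>h. ((1 + h) ^ Suc d - 1 ^ Suc d) / h) \<longlongrightarrow> real (Suc d)) (at 0)"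
      unfolding DERIV_def by simp
    have h: "filterlim (\<lambda>i. - 1 / real (Suc i)) (at (0::real)) sequentially"
      unfolding filterlim_at by (auto intro!: always_eventually) real_asymp
    have eq: "((1 + - 1 / real (Suc i)) ^ Suc d - 1 ^ Suc d) / (- 1 / real (Suc i)) = x i" for i
    proof -
      have "1 + - 1 / real (Suc i) = real i / real (Suc i)"
        by (simp add: field_simps)
      moreover have "((u / n) ^ Suc d - 1 ^ Suc d) / (- 1 / n) = (n ^ Suc d - u ^ Suc d) / n ^ d"
        if "n \<noteq> 0" for u n :: real
      proof -
        have "((u / n) ^ Suc d - 1 ^ Suc d) / (- 1 / n) = (1 - u ^ Suc d / n ^ Suc d) * n"
          by (simp add: power_divide algebra_simps del: power_Suc)
        also have "\<dots> = (n ^ Suc d - u ^ Suc d) / n ^ Suc d * n"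
          using that by (simp add: diff_divide_distrib del: power_Suc)
        also have "\<dots> = (n ^ Suc d - u ^ Suc d) / n ^ d"
          using that by simp
        finally show ?thesis .
      qed
      ultimately show ?thesis unfolding x_def by (metis of_nat_neq_0)
    qed
    show ?thesis using filterlim_compose[OF D h] unfolding eq .
  qed
  have tele: "(\<Sum>i\<le>t. x i * real (Suc i) ^ d) = real (Suc t) ^ Suc d" for t
  proof -
    have "x i * real (Suc i) ^ d = real (Suc i) ^ Suc d - real i ^ Suc d" for i
      by (simp add: x_def del: power_Suc of_nat_Suc)
    then have "(\<Sum>i\<le>t. x i * real (Suc i) ^ d)
        = (\<Sum>i<Suc t. real (Suc i) ^ Suc d - real i ^ Suc d)"
      by (simp only: lessThan_Suc_atMost)
    also have "\<dots> = real (Suc t) ^ Suc d - real 0 ^ Suc d"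
      by (rule sum_lessThan_telescope)
    finally show ?thesis by simp
  qed
  have est: "norm (1 - real (Suc d) * ((\<Sum>i\<le>t. real (Suc i) ^ d) / real (Suc t) ^ Suc d)) \<le> A t" for t
  proof -
    have "1 - real (Suc d) * ((\<Sum>i\<le>t. real (Suc i) ^ d) / real (Suc t) ^ Suc d)
        = (\<Sum>i\<le>t. (x i - real (Suc d)) * real (Suc i) ^ d) / real (Suc t) ^ Suc d"
      unfolding left_diff_distrib sum_subtractf tele diff_divide_distrib
      by (simp flip: sum_distrib_left del: power_Suc of_nat_Suc)
    also have "norm \<dots> \<le> (\<Sum>i\<le>t. \<bar>x i - real (Suc d)\<bar> * real (Suc t) ^ d) / real (Suc t) ^ Suc d"
      by (auto simp: abs_mult simp del: of_nat_Suc power_Suc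
          intro!: divide_right_mono order_trans[OF sum_abs] sum_mono mult_left_mono power_mono)
    also have "\<dots> = A t"
      by (simp add: A_def flip: sum_distrib_right)
    finally show ?thesis .
  qed
  have A0: "A \<longlonglongrightarrow> 0" unfolding A_def by (rule average_null[OF x_lim])
  have "(\<lambda>t. 1 - real (Suc d) * ((\<Sum>i\<le>t. real (Suc i) ^ d) / real (Suc t) ^ Suc d)) \<longlonglongrightarrow> 0"
    by (rule Lim_null_comparison[OF always_eventually A0]) (rule allI, rule est)
  then have "(\<lambda>t. (1 - (1 - real (Suc d) * ((\<Sum>i\<le>t. real (Suc i) ^ d) / real (Suc t) ^ Suc d)))
      / real (Suc d)) \<longlonglongrightarrow> (1 - 0) / real (Suc d)"
    by (intro tendsto_intros) auto
  then show ?thesis by (simp del: of_nat_Suc power_Suc)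
qed

text \<open>With equal exponential rates no term of the convolution dominates: about \<open>t\<close> of them
  contribute equally, which raises the polynomial degree by one. The error of replacing both
  factors by their limits is an average of null sequences.\<close>

lemma convolution_resonant:
  fixes a b :: "nat \<Rightarrow> real"
  assumes \<rho>: "0 < \<rho>" and a: "(\<lambda>t. a t / \<rho> ^ t) \<longlonglongrightarrow> \<alpha>"
    and b: "(\<lambda>t. b t / growth k \<rho> t) \<longlonglongrightarrow> \<beta>"
  shows "(\<lambda>t. (\<Sum>j\<le>t. a j * b (t - j)) / growth (Suc k) \<rho> t) \<longlonglongrightarrow> \<alpha> * \<beta> / real (Suc k)"
proof -
  define x where "x t = a t / \<rho> ^ t" for t
  define y where "y t = b t / growth k \<rho> t" for t
  define w where "w i = real (Suc i) ^ k" for i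
  obtain B where B: "\<And>t. \<bar>y t\<bar> \<le> B"
    using convergent_imp_Bseq[OF convergentI[OF b]] by (auto simp: Bseq_def y_def)
  define S where "S t = (\<Sum>i\<le>t. w i) / real (Suc t) ^ Suc k" for t
  define E where "E t = B * ((\<Sum>i\<le>t. \<bar>x i - \<alpha>\<bar>) / real (Suc t))
      + \<bar>\<alpha>\<bar> * ((\<Sum>i\<le>t. \<bar>y i - \<beta>\<bar>) / real (Suc t))" for t
  define T where "T t = (\<Sum>j\<le>t. a j * b (t - j)) / growth (Suc k) \<rho> t" for t
  have T_eq: "T t = (\<Sum>i\<le>t. x (t - i) * y i * w i) / real (Suc t) ^ Suc k" for t
  proof -
    have "(\<Sum>j\<le>t. a j * b (t - j)) = (\<Sum>i\<le>t. a (t - i) * b i)"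
      by (rule sum.reindex_bij_witness[of _ "\<lambda>i. t - i" "\<lambda>i. t - i"]) auto
    also have "\<dots> = (\<Sum>i\<le>t. x (t - i) * y i * w i * \<rho> ^ t)"
    proof (rule sum.cong)
      fix i assume "i \<in> {..t}"
      then have "\<rho> ^ t = \<rho> ^ (t - i) * \<rho> ^ i" by (simp flip: power_add)
      then show "a (t - i) * b i = x (t - i) * y i * w i * \<rho> ^ t"
        using \<rho> by (simp add: x_def y_def w_def growth_def)
    qed auto
    finally show ?thesis
      using \<rho> by (simp add: T_def growth_def flip: sum_distrib_right)
  qed
  have est: "norm (T t - \<alpha> * \<beta> * S t) \<le> E t" for t
  proof -
    have "T t - \<alpha> * \<beta> * S t
        = (\<Sum>i\<le>t. (x (t - i) * y i - \<alpha> * \<beta>) * w i) / real (Suc t) ^ Suc k"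
      unfolding T_eq S_def left_diff_distrib sum_subtractf diff_divide_distrib
      by (simp add: sum_distrib_left del: of_nat_Suc power_Suc)
    also have "norm \<dots> \<le> (\<Sum>i\<le>t. (\<bar>x (t - i) - \<alpha>\<bar> * B + \<bar>\<alpha>\<bar> * \<bar>y i - \<beta>\<bar>) * real (Suc t) ^ k)
        / real (Suc t) ^ Suc k"
    proof -
      have "\<bar>(x (t - i) * y i - \<alpha> * \<beta>) * w i\<bar>
          \<le> (\<bar>x (t - i) - \<alpha>\<bar> * B + \<bar>\<alpha>\<bar> * \<bar>y i - \<beta>\<bar>) * real (Suc t) ^ k" if "i \<le> t" for i
      proof -
        have "\<bar>x (t - i) * y i - \<alpha> * \<beta>\<bar> = \<bar>(x (t - i) - \<alpha>) * y i + \<alpha> * (y i - \<beta>)\<bar>"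
          by (simp add: algebra_simps)
        also have "\<dots> \<le> \<bar>x (t - i) - \<alpha>\<bar> * \<bar>y i\<bar> + \<bar>\<alpha>\<bar> * \<bar>y i - \<beta>\<bar>"
          by (rule order_trans[OF abs_triangle_ineq]) (simp add: abs_mult)
        also have "\<dots> \<le> \<bar>x (t - i) - \<alpha>\<bar> * B + \<bar>\<alpha>\<bar> * \<bar>y i - \<beta>\<bar>"
          by (intro add_mono mult_left_mono B) auto
        finally have "\<bar>x (t - i) * y i - \<alpha> * \<beta>\<bar> * \<bar>w i\<bar>
            \<le> (\<bar>x (t - i) - \<alpha>\<bar> * B + \<bar>\<alpha>\<bar> * \<bar>y i - \<beta>\<bar>) * real (Suc t) ^ k"
          by (rule mult_mono) (use that order_trans[OF abs_ge_zero B]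
              in \<open>auto simp: w_def intro!: power_mono\<close>)
        then show ?thesis by (simp add: abs_mult)
      qed
      then have "\<bar>\<Sum>i\<le>t. (x (t - i) * y i - \<alpha> * \<beta>) * w i\<bar>
          \<le> (\<Sum>i\<le>t. (\<bar>x (t - i) - \<alpha>\<bar> * B + \<bar>\<alpha>\<bar> * \<bar>y i - \<beta>\<bar>) * real (Suc t) ^ k)"
        by (intro order_trans[OF sum_abs] sum_mono) auto
      then show ?thesis
        by (simp add: divide_right_mono del: of_nat_Suc power_Suc)
    qed
    also have "\<dots> = (\<Sum>i\<le>t. \<bar>x (t - i) - \<alpha>\<bar> * B + \<bar>\<alpha>\<bar> * \<bar>y i - \<beta>\<bar>) / real (Suc t)"
      by (simp flip: sum_distrib_right)
    also have "\<dots> = B * ((\<Sum>i\<le>t. \<bar>x (t - i) - \<alpha>\<bar>) / real (Suc t))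
        + \<bar>\<alpha>\<bar> * ((\<Sum>i\<le>t. \<bar>y i - \<beta>\<bar>) / real (Suc t))"
      by (simp add: sum.distrib add_divide_distrib mult.commute
          flip: sum_distrib_left sum_distrib_right)
    also have "(\<Sum>i\<le>t. \<bar>x (t - i) - \<alpha>\<bar>) = (\<Sum>i\<le>t. \<bar>x i - \<alpha>\<bar>)"
      by (rule sum.reindex_bij_witness[of _ "\<lambda>i. t - i" "\<lambda>i. t - i"]) auto
    finally show ?thesis by (simp add: E_def)
  qed
  have "E \<longlonglongrightarrow> B * 0 + \<bar>\<alpha>\<bar> * 0"
    unfolding E_def x_def y_def by (intro tendsto_intros average_null a b)
  then have E0: "E \<longlonglongrightarrow> 0" by simp
  have "(\<lambda>t. T t - \<alpha> * \<beta> * S t) \<longlonglongrightarrow> 0"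
    by (rule Lim_null_comparison[OF always_eventually E0]) (rule allI, rule est)
  moreover have "(\<lambda>t. \<alpha> * \<beta> * S t) \<longlonglongrightarrow> \<alpha> * \<beta> * (1 / real (Suc k))"
    unfolding S_def w_def by (intro tendsto_intros power_sum_asymptotics)
  ultimately have "(\<lambda>t. (T t - \<alpha> * \<beta> * S t) + \<alpha> * \<beta> * S t) \<longlonglongrightarrow> 0 + \<alpha> * \<beta> * (1 / real (Suc k))"
    by (rule tendsto_add)
  then show ?thesis by (simp add: T_def)
qed

section \<open>Perron--Frobenius theory of a positive block\<close>

text \<open>Brouwer's theorem for the normalised action of \<open>K\<close> on the probability vectors supported
  in \<open>C\<close>. Positivity of \<open>K\<close> makes every image vector, hence the fixed point, positive.\<close>

lemma positive_eigenvector: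
  fixes K :: "'a::finite \<Rightarrow> 'a \<Rightarrow> real"
  assumes C: "C \<noteq> {}" and K: "\<And>b c. b \<in> C \<Longrightarrow> c \<in> C \<Longrightarrow> 0 < K b c"
  shows "\<exists>u \<kappa>. 0 < \<kappa> \<and> (\<forall>b\<in>C. 0 < u b \<and> (\<Sum>c\<in>C. K b c * u c) = \<kappa> * u b)"
proof -
  define S where "S = {x :: real^'a. (\<forall>i. 0 \<le> x $ i) \<and> (\<forall>i\<in>-C. x $ i = 0) \<and> (\<Sum>i\<in>UNIV. x $ i) = 1}"
  define L where "L x b = (\<Sum>c\<in>C. K b c * x $ c)" for x :: "real^'a" and b
  define tot where "tot x = (\<Sum>b\<in>C. L x b)" for x
  define f where "f x = (\<chi> b. if b \<in> C then L x b / tot x else 0)" for x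
  have Lpos: "0 < L x b" if "x \<in> S" "b \<in> C" for x b
  proof -
    have "\<exists>i. x $ i \<noteq> 0"
      using that by (auto simp: S_def intro: ccontr)
    then obtain c where "x $ c \<noteq> 0" by auto
    with that(1) have c: "c \<in> C" "x $ c > 0"
      unfolding S_def by (force, simp add: order_less_le)
    show ?thesis
      unfolding L_def
    proof (rule sum_pos2)
      show "0 < K b c * x $ c" using c K that by simp
      show "\<And>i. i \<in> C \<Longrightarrow> 0 \<le> K b i * x $ i"
        using K that by (auto simp: S_def less_imp_le)
    qed (use c in auto)
  qed
  have totpos: "0 < tot x" if "x \<in> S" for x
    unfolding tot_def using C Lpos[OF that] by (intro sum_pos) auto
  have "compact S"
  proof -
    have "closed S"
    proof -
      have "S = (\<Inter>i. {x. 0 \<le> x $ i}) \<inter> (\<Inter>i\<in>-C. {x. x $ i = 0}) \<inter> {x. (\<Sum>i\<in>UNIV. x $ i) = 1}"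
        by (auto simp: S_def)
      also have "closed \<dots>"
        by (intro closed_Int closed_INT ballI closed_Collect_le closed_Collect_eq continuous_intros)
      finally show ?thesis .
    qed
    moreover have "bounded S"
      unfolding bounded_iff
    proof (intro exI ballI)
      fix x assume "x \<in> S"
      then show "norm x \<le> 1"
        using norm_le_l1_cart[of x] by (simp add: S_def)
    qed
    ultimately show ?thesis by (simp add: compact_eq_bounded_closed)
  qed
  moreover have "convex S"
    unfolding convex_def
  proof (intro ballI allI impI)
    fix x y :: "real^'a" and v w :: real
    assume xy: "x \<in> S" "y \<in> S" and vw: "0 \<le> v" "0 \<le> w" "v + w = 1"
    have "(\<Sum>i\<in>UNIV. (v *\<^sub>R x + w *\<^sub>R y) $ i) = v * (\<Sum>i\<in>UNIV. x $ i) + w * (\<Sum>i\<in>UNIV. y $ i)"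
      by (simp add: sum.distrib sum_distrib_left)
    then show "v *\<^sub>R x + w *\<^sub>R y \<in> S"
      using xy vw by (simp add: S_def)
  qed
  moreover have "S \<noteq> {}"
  proof -
    obtain c where "c \<in> C" using C by auto
    then have "axis c 1 \<in> S"
      by (auto simp: S_def axis_def)
    then show ?thesis by auto
  qed
  moreover have "continuous_on S f"
  proof -
    have L_cont: "continuous_on S (\<lambda>x. L x b)" for b
      unfolding L_def by (intro continuous_intros)
    show ?thesis
      unfolding f_def
    proof (rule continuous_on_vec_lambda)
      fix b
      show "continuous_on S (\<lambda>x. if b \<in> C then L x b / tot x else 0)"
      proof (cases "b \<in> C")
        case True
        have "continuous_on S (\<lambda>x. L x b / tot x)"
          unfolding tot_def
          by (intro continuous_intros L_cont ballI)
            (metis tot_def totpos less_irrefl)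
        then show ?thesis using True by simp
      qed simp
    qed
  qed
  moreover have "f \<in> S \<rightarrow> S"
  proof
    fix x assume x: "x \<in> S"
    have "(\<Sum>i\<in>UNIV. f x $ i) = (\<Sum>i\<in>UNIV \<inter> C. L x i / tot x)"
      unfolding f_def by (simp add: sum.If_cases)
    also have "\<dots> = 1"
      using totpos[OF x] by (simp add: tot_def[symmetric] sum_divide_distrib[symmetric])
    finally show "f x \<in> S"
      using Lpos[OF x] totpos[OF x] by (auto simp: S_def f_def less_imp_le)
  qed
  ultimately obtain x where x: "x \<in> S" "f x = x"
    by (rule brouwer)
  have eig: "L x b = tot x * x $ b" if "b \<in> C" for b
  proof -
    have "x $ b = L x b / tot x"
      using that arg_cong[OF x(2), of "\<lambda>x. x $ b"] by (simp add: f_def)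
    then show ?thesis using totpos[OF x(1)] by simp
  qed
  show ?thesis
  proof (intro exI[of _ "\<lambda>b. x $ b"] exI[of _ "tot x"] conjI ballI)
    show "0 < tot x" by (rule totpos[OF x(1)])
    show "0 < x $ b" if "b \<in> C" for b
      using eig[OF that] Lpos[OF x(1) that] totpos[OF x(1)] by (simp add: zero_less_mult_iff)
    show "(\<Sum>c\<in>C. K b c * x $ c) = tot x * x $ b" if "b \<in> C" for b
      using eig[OF that] by (simp add: L_def)
  qed
qed

text \<open>Averaging with weights at least \<open>\<delta>\<close> moves the maximum down and the minimum up, and it
  shrinks the gap between them by the factor \<open>1 - \<delta>\<close>.\<close>

lemma positive_stochastic_mixing:
  fixes R :: "'a::finite \<Rightarrow> 'a \<Rightarrow> real" and q :: "nat \<Rightarrow> 'a \<Rightarrow> real"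
  assumes C: "C \<noteq> {}" and R: "\<And>b c. b \<in> C \<Longrightarrow> c \<in> C \<Longrightarrow> 0 < R b c"
    and stoch: "\<And>b. b \<in> C \<Longrightarrow> (\<Sum>c\<in>C. R b c) = 1"
    and step: "\<And>t b. b \<in> C \<Longrightarrow> q (Suc t) b = (\<Sum>c\<in>C. R b c * q t c)"
    and pos: "\<And>b. b \<in> C \<Longrightarrow> 0 < q 1 b"
  shows "\<exists>L. 0 < L \<and> (\<forall>b\<in>C. (\<lambda>t. q t b) \<longlonglongrightarrow> L)"
proof -
  define M where "M t = Max (q t ` C)" for t
  define m where "m t = Min (q t ` C)" for t
  have fin: "finite (q t ` C)" "q t ` C \<noteq> {}" for t using C by auto
  have M: "q t b \<le> M t" and m: "m t \<le> q t b" if "b \<in> C" for t b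
    using that by (auto simp: M_def m_def)
  define \<delta> where "\<delta> = Min ((\<lambda>(b, c). R b c) ` (C \<times> C))"
  have \<delta>0: "0 < \<delta>"
    unfolding \<delta>_def using C R by (subst Min_gr_iff) auto
  have \<delta>: "\<delta> \<le> R b c" if "b \<in> C" "c \<in> C" for b c
    unfolding \<delta>_def using that by (intro Min_le) (auto intro: rev_image_eqI)
  have \<delta>1: "\<delta> \<le> 1"
  proof -
    obtain b where b: "b \<in> C" using C by auto
    have "R b b \<le> (\<Sum>c\<in>C. R b c)"
      using R b by (intro member_le_sum) (auto intro: less_imp_le)
    then show ?thesis using \<delta>[OF b b] stoch[OF b] by simp
  qed
  have up: "q (Suc t) b \<le> M t - \<delta> * (M t - m t)" if b: "b \<in> C" for t b
  proof -
    obtain c where c: "c \<in> C" "q t c = m t"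
      using Min_in[OF fin, of t] by (auto simp: m_def)
    have "\<delta> * (M t - m t) \<le> R b c * (M t - q t c)"
      using \<delta>[OF b c(1)] M[OF c(1), of t] c(2) by (simp add: mult_right_mono)
    also have "\<dots> \<le> (\<Sum>c\<in>C. R b c * (M t - q t c))"
      using R b M c by (intro member_le_sum) (auto simp: less_imp_le)
    also have "\<dots> = M t - q (Suc t) b"
      by (simp add: step[OF b] right_diff_distrib sum_subtractf stoch[OF b] flip: sum_distrib_right)
    finally show ?thesis by simp
  qed
  have low: "m t \<le> q (Suc t) b" if b: "b \<in> C" for t b
  proof -
    have "m t = (\<Sum>c\<in>C. R b c * m t)"
      by (simp add: stoch[OF b] flip: sum_distrib_right)
    also have "\<dots> \<le> q (Suc t) b"
      unfolding step[OF b] using R b m by (intro sum_mono mult_left_mono) (auto intro: less_imp_le)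
    finally show ?thesis .
  qed
  have mM: "m t \<le> M t" for t
    using C m[of _ t] M[of _ t] by (meson ex_in_conv order_trans)
  have M_Suc: "M (Suc t) \<le> M t - \<delta> * (M t - m t)" for t
    unfolding M_def[of "Suc t"] using up fin by (subst Max_le_iff) auto
  have m_Suc: "m t \<le> m (Suc t)" for t
    unfolding m_def[of "Suc t"] using low fin by (subst Min_ge_iff) auto
  have gap: "M t - m t \<le> (1 - \<delta>) ^ t * (M 0 - m 0)" for t
  proof (induction t)
    case (Suc t)
    have "M (Suc t) - m (Suc t) \<le> (1 - \<delta>) * (M t - m t)"
      using M_Suc[of t] m_Suc[of t] by (simp add: algebra_simps)
    also have "\<dots> \<le> (1 - \<delta>) * ((1 - \<delta>) ^ t * (M 0 - m 0))"
      using Suc \<delta>1 by (intro mult_left_mono) auto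
    finally show ?case by (simp add: mult.assoc)
  qed simp
  have gap_lim: "(\<lambda>t. M t - m t) \<longlonglongrightarrow> 0"
  proof -
    have lim: "(\<lambda>t. (1 - \<delta>) ^ t * (M 0 - m 0)) \<longlonglongrightarrow> 0"
      using LIMSEQ_power_zero[of "1 - \<delta>"] \<delta>0 \<delta>1 by (auto intro!: tendsto_mult_left_zero)
    show ?thesis
      by (rule tendsto_sandwich[OF _ _ tendsto_const lim]) (use gap mM in auto)
  qed
  have inc: "incseq m" by (rule incseq_SucI) (rule m_Suc)
  have dec: "M t \<le> M 0" for t
  proof (induction t)
    case (Suc t)
    have "0 \<le> \<delta> * (M t - m t)" using \<delta>0 mM[of t] by simp
    then show ?case using M_Suc[of t] Suc by linarith
  qed simp
  have "\<forall>t. m t \<le> M 0" using mM dec by (blast intro: order_trans)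
  then obtain L where L: "m \<longlonglongrightarrow> L" "\<And>t. m t \<le> L"
    using incseq_convergent[OF inc] by blast
  have M_lim: "M \<longlonglongrightarrow> L"
    using tendsto_add[OF gap_lim L(1)] by simp
  show ?thesis
  proof (intro exI[of _ L] conjI ballI)
    have "0 < m 1" unfolding m_def using pos fin[of 1] by (subst Min_gr_iff) auto
    then show "0 < L" using L(2)[of 1] by linarith
    show "(\<lambda>t. q t b) \<longlonglongrightarrow> L" if "b \<in> C" for b
      by (rule tendsto_sandwich[OF always_eventually always_eventually L(1) M_lim])
        (use m M that in auto)
  qed
qed

text \<open>Powers of the submatrix of \<open>K\<close> on \<open>C \<times> C\<close>: the sum runs over \<open>C\<close> only, while the indices
  range over the whole type. For \<open>C = UNIV\<close> these are the powers of \<open>K\<close> itself.\<close>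

primrec block_power :: "'a set \<Rightarrow> ('a \<Rightarrow> 'a \<Rightarrow> real) \<Rightarrow> nat \<Rightarrow> 'a \<Rightarrow> 'a \<Rightarrow> real" where
  "block_power C K 0 b c = of_bool (b = c)"
| "block_power C K (Suc t) b c = (\<Sum>d\<in>C. K b d * block_power C K t d c)"

text \<open>Perron--Frobenius for a positive block. Conjugating \<open>K / \<kappa>\<close> by the diagonal matrix of a
  positive eigenvector \<open>u\<close> gives a row-stochastic matrix, whose powers mix.\<close>

lemma positive_block_growth:
  fixes K :: "'a::finite \<Rightarrow> 'a \<Rightarrow> real"
  assumes C: "C \<noteq> {}" and K: "\<And>b c. b \<in> C \<Longrightarrow> c \<in> C \<Longrightarrow> 0 < K b c"
  shows "\<exists>\<kappa> p. 0 < \<kappa> \<and> (\<forall>b\<in>C. \<forall>c\<in>C. 0 < p b c \<and>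
    (\<lambda>t. block_power C K t b c / \<kappa> ^ t) \<longlonglongrightarrow> p b c)"
proof -
  obtain u \<kappa> where \<kappa>: "0 < \<kappa>" and u: "\<And>b. b \<in> C \<Longrightarrow> 0 < u b"
    and eig: "\<And>b. b \<in> C \<Longrightarrow> (\<Sum>c\<in>C. K b c * u c) = \<kappa> * u b"
    using positive_eigenvector[of C K] C K by metis
  define R where "R b c = K b c * u c / (\<kappa> * u b)" for b c
  have R: "0 < R b c" if "b \<in> C" "c \<in> C" for b c
    using that K u \<kappa> by (simp add: R_def)
  have stoch: "(\<Sum>c\<in>C. R b c) = 1" if "b \<in> C" for b
    using eig[OF that] u[OF that] \<kappa> by (simp add: R_def flip: sum_divide_distrib)
  have "\<exists>L. 0 < L \<and> (\<forall>b\<in>C. (\<lambda>t. block_power C K t b c / (\<kappa> ^ t * u b)) \<longlonglongrightarrow> L)"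
    if c: "c \<in> C" for c
  proof -
    define q where "q t b = block_power C K t b c / (\<kappa> ^ t * u b)" for t b
    have step: "q (Suc t) b = (\<Sum>d\<in>C. R b d * q t d)" if b: "b \<in> C" for t b
      unfolding q_def R_def block_power.simps sum_divide_distrib
    proof (rule sum.cong)
      fix d assume "d \<in> C"
      then have "u d \<noteq> 0" using u by force
      then show "K b d * block_power C K t d c / (\<kappa> ^ Suc t * u b)
          = K b d * u d / (\<kappa> * u b) * (block_power C K t d c / (\<kappa> ^ t * u d))"
        by simp
    qed simp
    have q0: "q 0 b = (if b = c then 1 / u c else 0)" for b
      by (simp add: q_def)
    have "0 < q 1 b" if b: "b \<in> C" for b
    proof -
      have "q 1 b = (\<Sum>d\<in>C. if d = c then R b c * (1 / u c) else 0)"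
        using step[OF b, of 0] by (simp add: q0 if_distrib cong: if_cong)
      also have "\<dots> = R b c * (1 / u c)" using c by simp
      finally show ?thesis using R[OF b c] u[OF c] by simp
    qed
    then have "\<exists>L. 0 < L \<and> (\<forall>b\<in>C. (\<lambda>t. q t b) \<longlonglongrightarrow> L)"
      by (intro positive_stochastic_mixing[of C R q] C R stoch step)
    then show ?thesis by (simp add: q_def)
  qed
  then obtain L where L: "\<And>c. c \<in> C \<Longrightarrow> 0 < L c"
    "\<And>b c. b \<in> C \<Longrightarrow> c \<in> C \<Longrightarrow> (\<lambda>t. block_power C K t b c / (\<kappa> ^ t * u b)) \<longlonglongrightarrow> L c"
    by metis
  show ?thesis
  proof (intro exI[of _ \<kappa>] exI[of _ "\<lambda>b c. u b * L c"] conjI ballI)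
    show "0 < \<kappa>" by (rule \<kappa>)
    show "0 < u b * L c" if "b \<in> C" "c \<in> C" for b c using that u L by simp
    show "(\<lambda>t. block_power C K t b c / \<kappa> ^ t) \<longlonglongrightarrow> u b * L c" if bc: "b \<in> C" "c \<in> C" for b c
      using tendsto_mult[OF tendsto_const L(2)[OF bc], of "u b"] u[OF bc(1)] by simp
  qed
qed

section \<open>Powers of a matrix with transitive support\<close>

lemma block_power_nonneg:
  assumes "\<And>b c. 0 \<le> K b c"
  shows "0 \<le> block_power C K t b c"
  by (induction t arbitrary: b) (auto intro!: sum_nonneg mult_nonneg_nonneg assms)

text \<open>A path from \<open>C\<close> either stays in \<open>C\<close> or splits at the moment when it leaves \<open>C\<close> for \<open>D\<close>:
  \<open>j\<close> steps inside \<open>C\<close>, one step into \<open>D\<close>, and then anything. Summing the weights of these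
  paths turns the powers of the full matrix into a convolution.\<close>

lemma block_power_decomposition:
  fixes N :: "'a::finite \<Rightarrow> 'a \<Rightarrow> real"
  assumes disj: "C \<inter> D = {}" and supp: "\<And>b c. b \<in> C \<Longrightarrow> c \<notin> C \<union> D \<Longrightarrow> N b c = 0"
    and b: "b \<in> C"
  defines "H \<equiv> \<lambda>i c e. \<Sum>d\<in>D. N c d * block_power UNIV N i d e"
  shows "block_power UNIV N t b e = (if e \<in> C then block_power C N t b e else 0)
    + (\<Sum>j<t. \<Sum>c\<in>C. block_power C N j b c * H (t - Suc j) c e)"
  using b
proof (induction t arbitrary: b)
  case 0
  then show ?case by auto
next
  case (Suc t)
  let ?P = "\<lambda>t b. if e \<in> C then block_power C N t b e else 0"
  let ?Q = "\<lambda>j b i. \<Sum>c\<in>C. block_power C N j b c * H i c e"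
  have "block_power UNIV N (Suc t) b e = (\<Sum>c\<in>C \<union> D. N b c * block_power UNIV N t c e)"
    unfolding block_power.simps
    by (rule sum.mono_neutral_right) (use supp[OF Suc.prems] in auto)
  also have "\<dots> = (\<Sum>c\<in>C. N b c * block_power UNIV N t c e) + H t b e"
    using disj by (simp add: sum.union_disjoint H_def)
  also have "(\<Sum>c\<in>C. N b c * block_power UNIV N t c e)
      = (\<Sum>c\<in>C. N b c * ?P t c) + (\<Sum>c\<in>C. N b c * (\<Sum>j<t. ?Q j c (t - Suc j)))"
    by (simp add: Suc.IH distrib_left sum.distrib)
  also have "(\<Sum>c\<in>C. N b c * ?P t c) = ?P (Suc t) b"
    by simp
  also have "(\<Sum>c\<in>C. N b c * (\<Sum>j<t. ?Q j c (t - Suc j))) = (\<Sum>j<t. \<Sum>c\<in>C. N b c * ?Q j c (t - Suc j))"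
    unfolding sum_distrib_left by (rule sum.swap)
  also have "\<dots> = (\<Sum>j<t. ?Q (Suc j) b (t - Suc j))"
  proof (rule sum.cong)
    fix j
    have "(\<Sum>c\<in>C. N b c * ?Q j c (t - Suc j))
        = (\<Sum>c'\<in>C. \<Sum>c\<in>C. N b c * (block_power C N j c c' * H (t - Suc j) c' e))"
      unfolding sum_distrib_left by (rule sum.swap)
    also have "\<dots> = ?Q (Suc j) b (t - Suc j)"
      by (simp add: sum_distrib_right mult.assoc)
    finally show "(\<Sum>c\<in>C. N b c * ?Q j c (t - Suc j)) = ?Q (Suc j) b (t - Suc j)" .
  qed simp
  also have "H t b e = ?Q 0 b t"
  proof -
    have "?Q 0 b t = (\<Sum>c\<in>C. if b = c then H t c e else 0)"
      by (intro sum.cong) auto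
    then show ?thesis using Suc.prems by simp
  qed
  finally show ?case
    unfolding sum.lessThan_Suc_shift[of _ t] diff_Suc_Suc by simp
qed

definition has_growth :: "(nat \<Rightarrow> 'e \<Rightarrow> real) \<Rightarrow> nat \<Rightarrow> real \<Rightarrow> ('e \<Rightarrow> real) \<Rightarrow> bool" where
  "has_growth x k \<rho> v \<longleftrightarrow> 0 < \<rho> \<and> (\<forall>e. (\<lambda>t. x t e / growth k \<rho> t) \<longlonglongrightarrow> v e)"

lemma has_growth_faster:
  assumes x: "has_growth x k \<rho> v" and "0 < \<rho>'" "\<rho> < \<rho>' \<or> \<rho> = \<rho>' \<and> k < k'"
  shows "has_growth x k' \<rho>' (\<lambda>_. 0)"
proof -
  have \<rho>: "0 < \<rho>" using x by (simp add: has_growth_def)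
  have "(\<lambda>t. x t e / growth k' \<rho>' t) \<longlonglongrightarrow> 0" for e
  proof -
    have "(\<lambda>t. x t e / growth k \<rho> t * (growth k \<rho> t / growth k' \<rho>' t)) \<longlonglongrightarrow> v e * 0"
      using x assms(2,3) by (intro tendsto_mult growth_ratio_lim) (auto simp: has_growth_def)
    then show ?thesis
      using growth_pos[OF \<rho>] by (simp add: less_imp_neq[symmetric])
  qed
  then show ?thesis using assms by (simp add: has_growth_def)
qed

text \<open>Rescaling by the fastest of the growth rates sends the slower vectors to zero and keeps
  the limit of a fastest one.\<close>

lemma common_growth:
  assumes "finite S" "S \<noteq> {}" "\<And>d. d \<in> S \<Longrightarrow> \<exists>k \<rho> v. has_growth (x d) k \<rho> v \<and> (\<exists>e. v e \<noteq> 0)"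
  shows "\<exists>k \<rho> v. (\<forall>d\<in>S. has_growth (x d) k \<rho> (v d)) \<and> (\<exists>d\<in>S. \<exists>e. v d e \<noteq> 0)"
  using assms
proof (induction S rule: finite_ne_induct)
  case (singleton d)
  then obtain k \<rho> v where "has_growth (x d) k \<rho> v" "\<exists>e. v e \<noteq> 0" by blast
  then show ?case by (intro exI[of _ k] exI[of _ \<rho>] exI[of _ "\<lambda>_. v"]) auto
next
  case (insert d S)
  obtain k \<rho> v where v: "\<And>d. d \<in> S \<Longrightarrow> has_growth (x d) k \<rho> (v d)" "\<exists>d\<in>S. \<exists>e. v d e \<noteq> 0"
    using insert by (metis insertI2)
  obtain k' \<rho>' v' where v': "has_growth (x d) k' \<rho>' v'" "\<exists>e. v' e \<noteq> 0"
    using insert.prems by blast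
  have pos: "0 < \<rho>" "0 < \<rho>'"
    using v v'(1) by (auto simp: has_growth_def)
  consider "\<rho> = \<rho>' \<and> k = k'" | "\<rho> < \<rho>' \<or> \<rho> = \<rho>' \<and> k < k'" | "\<rho>' < \<rho> \<or> \<rho>' = \<rho> \<and> k' < k"
    by linarith
  then show ?case
  proof cases
    case 1
    then show ?thesis
      using v v' insert.hyps
      by (intro exI[of _ k] exI[of _ \<rho>] exI[of _ "v(d := v')"]) auto
  next
    case 2
    then show ?thesis
      using v' insert.hyps has_growth_faster[OF v(1) pos(2)]
      by (intro exI[of _ k'] exI[of _ \<rho>'] exI[of _ "(\<lambda>_ _. 0)(d := v')"]) auto
  next
    case 3
    let ?v = "v(d := (\<lambda>_. 0))"
    have "\<forall>c\<in>insert d S. has_growth (x c) k \<rho> (?v c)"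
      using 3 v(1) has_growth_faster[OF v'(1) pos(1)] by auto
    moreover have "\<exists>c\<in>insert d S. \<exists>e. ?v c e \<noteq> 0"
      using v(2) insert.hyps by (metis fun_upd_other insertI2)
    ultimately show ?thesis by blast
  qed
qed

text \<open>Convergence on a scale is only useful with a nonzero limit. A lower bound for one
  coordinate that is itself of the order of the scale avoids computing that limit.\<close>

lemma has_growth_of_lower_bound:
  assumes \<rho>: "0 < \<rho>" and conv: "\<And>e. convergent (\<lambda>t. x (Suc t) e / growth k \<rho> t)"
    and le: "\<And>t. y t \<le> x (Suc t) e" and y: "(\<lambda>t. y t / growth k \<rho> t) \<longlonglongrightarrow> l" "0 < l"
  shows "\<exists>k \<rho> v. has_growth x k \<rho> v \<and> (\<exists>e. v e \<noteq> 0)"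
proof -
  obtain L where L: "\<And>e. (\<lambda>t. x (Suc t) e / growth k \<rho> t) \<longlonglongrightarrow> L e"
    using conv unfolding convergent_def by metis
  have "l \<le> L e"
    by (rule LIMSEQ_le[OF y(1) L], intro exI allI impI divide_right_mono le
        less_imp_le[OF growth_pos[OF \<rho>]])
  then have "L e / \<rho> \<noteq> 0" using y(2) \<rho> by simp
  moreover have "has_growth x k \<rho> (\<lambda>e. L e / \<rho>)"
    using \<rho> tendsto_growth_shift[OF \<rho> L] by (auto simp: has_growth_def)
  ultimately show ?thesis by blast
qed

text \<open>Induction over the set of indices reachable from \<open>a\<close>. Transitivity of the support makes
  the class \<open>C\<close> of indices that communicate with \<open>a\<close> either empty or a positive block, and lets
  every remaining successor, collected in \<open>D\<close>, reach strictly fewer indices. The block grows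
  like \<open>\<kappa> ^ t\<close>, the fastest index in \<open>D\<close> like \<open>growth k \<rho> t\<close>, and the convolution of the two
  follows the larger of the two rates, with one extra polynomial degree if \<open>\<kappa> = \<rho>\<close>.\<close>

theorem transitive_matrix_growth:
  fixes N :: "'a::finite \<Rightarrow> 'a \<Rightarrow> real"
  assumes nonneg: "\<And>b c. 0 \<le> N b c"
    and trans: "\<And>b c d. 0 < N b c \<Longrightarrow> 0 < N c d \<Longrightarrow> 0 < N b d"
    and rows: "\<And>b. \<exists>c. 0 < N b c"
  shows "\<exists>k \<rho> v. has_growth (\<lambda>t e. block_power UNIV N t a e) k \<rho> v \<and> (\<exists>e. v e \<noteq> 0)"
proof (induction "card (insert a {b. 0 < N a b})" arbitrary: a rule: less_induct)
  case less
  define X where "X = block_power UNIV N"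
  have X0: "0 \<le> X t b c" for t b c
    unfolding X_def by (rule block_power_nonneg[OF nonneg])
  define C where "C = {b. 0 < N a b \<and> 0 < N b a}"
  define D where "D = {d. 0 < N a d \<and> \<not> 0 < N d a}"
  have disj: "C \<inter> D = {}" by (auto simp: C_def D_def)
  have zero: "N b c = 0" if "\<not> 0 < N b c" for b c
    using nonneg[of b c] that by simp
  have Cpos: "0 < N b c" if "b \<in> C" "c \<in> C" for b c
    using that trans[of b a c] by (auto simp: C_def)
  have supp: "N b c = 0" if "b \<in> C" "c \<notin> C \<union> D" for b c
    using that trans[of a b c] zero[of b c] by (auto simp: C_def D_def)
  have aC: "a \<in> C" if "C \<noteq> {}"
    using that trans by (auto simp: C_def)
  \<comment> \<open>\<open>d\<close> reaches only what \<open>a\<close> reaches, but not \<open>a\<close> itself\<close>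
  have IH: "\<exists>k \<rho> v. has_growth (\<lambda>t. X t d) k \<rho> v \<and> (\<exists>e. v e \<noteq> 0)" if d: "d \<in> D" for d
  proof -
    have "insert d {b. 0 < N d b} \<subset> insert a {b. 0 < N a b}"
    proof (intro psubsetI notI)
      show "insert d {b. 0 < N d b} \<subseteq> insert a {b. 0 < N a b}"
        using d trans[of a d] by (auto simp: D_def)
      assume "insert d {b. 0 < N d b} = insert a {b. 0 < N a b}"
      then have "a = d \<or> 0 < N d a" by blast
      then show False using d by (auto simp: D_def)
    qed
    then have "card (insert d {b. 0 < N d b}) < card (insert a {b. 0 < N a b})"
      by (intro psubset_card_mono) auto
    from less[OF this] show ?thesis by (simp add: X_def)
  qed
  have X_ge: "N a d * X t d e \<le> X (Suc t) a e" for t d e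
    unfolding X_def block_power.simps
    by (rule member_le_sum[of d UNIV "\<lambda>d. N a d * block_power UNIV N t d e"])
      (auto intro!: mult_nonneg_nonneg nonneg block_power_nonneg)
  have growth_D: "\<exists>k \<rho> v. 0 < \<rho> \<and> (\<forall>d\<in>D. \<forall>e. (\<lambda>t. X t d e / growth k \<rho> t) \<longlonglongrightarrow> v d e)
      \<and> (\<exists>d\<in>D. \<exists>e. 0 < v d e)" if D: "D \<noteq> {}"
  proof -
    obtain k \<rho> v d e where v: "\<And>d. d \<in> D \<Longrightarrow> has_growth (\<lambda>t. X t d) k \<rho> (v d)" "d \<in> D" "v d e \<noteq> 0"
      using common_growth[of D "\<lambda>d t. X t d", OF _ D] IH unfolding X_def by (metis finite)
    then have "(\<lambda>t. X t d e / growth k \<rho> t) \<longlonglongrightarrow> v d e" "0 < \<rho>"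
      by (auto simp: has_growth_def)
    then have "0 \<le> v d e"
      by (intro LIMSEQ_le_const) (auto intro!: divide_nonneg_pos X0 growth_pos)
    then have "0 < v d e" using v(3) by simp
    then show ?thesis using v unfolding has_growth_def by blast
  qed
  show ?case
  proof (cases "C = {}")
    case True
    have row: "N a d = 0" if "d \<notin> D" for d
      using that True zero[of a d] by (auto simp: C_def D_def)
    have "D \<noteq> {}" using rows[of a] row by (auto dest: less_imp_neq)
    then obtain k \<rho> v d\<^sub>0 e\<^sub>0 where \<rho>: "0 < \<rho>"
      and v: "\<And>d e. d \<in> D \<Longrightarrow> (\<lambda>t. X t d e / growth k \<rho> t) \<longlonglongrightarrow> v d e"
      and d0: "d\<^sub>0 \<in> D" "0 < v d\<^sub>0 e\<^sub>0"
      using growth_D by metis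
    have "X (Suc t) a e / growth k \<rho> t = (\<Sum>d\<in>D. N a d * (X t d e / growth k \<rho> t))" for t e
    proof -
      have "X (Suc t) a e = (\<Sum>d\<in>D. N a d * X t d e)"
        unfolding X_def block_power.simps
        by (rule sum.mono_neutral_right) (auto simp: row)
      then show ?thesis by (simp add: sum_divide_distrib)
    qed
    moreover have "convergent (\<lambda>t. \<Sum>d\<in>D. N a d * (X t d e / growth k \<rho> t))" for e
      by (intro convergent_sum convergent_mult convergent_const convergentI[OF v])
    ultimately have "convergent (\<lambda>t. X (Suc t) a e / growth k \<rho> t)" for e by simp
    moreover have "(\<lambda>t. N a d\<^sub>0 * X t d\<^sub>0 e\<^sub>0 / growth k \<rho> t) \<longlonglongrightarrow> N a d\<^sub>0 * v d\<^sub>0 e\<^sub>0"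
      using tendsto_mult[OF tendsto_const v[OF d0(1), of e\<^sub>0], of "N a d\<^sub>0"] by simp
    moreover have "0 < N a d\<^sub>0 * v d\<^sub>0 e\<^sub>0" using d0 by (auto simp: D_def)
    ultimately show ?thesis
      using has_growth_of_lower_bound[OF \<rho>, of "\<lambda>t. X t a" k "\<lambda>t. N a d\<^sub>0 * X t d\<^sub>0 e\<^sub>0" e\<^sub>0] X_ge
      unfolding X_def by metis
  next
    case False
    note a = aC[OF False]
    obtain \<kappa> p where \<kappa>: "0 < \<kappa>" and p: "\<And>b c. b \<in> C \<Longrightarrow> c \<in> C \<Longrightarrow> 0 < p b c"
      and p_lim: "\<And>b c. b \<in> C \<Longrightarrow> c \<in> C \<Longrightarrow> (\<lambda>t. block_power C N t b c / \<kappa> ^ t) \<longlonglongrightarrow> p b c"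
      using positive_block_growth[of C N] False Cpos by metis
    \<comment> \<open>the count at \<open>t + 1\<close> splits into paths inside \<open>C\<close> (\<open>P\<close>) and paths leaving it (\<open>V\<close>)\<close>
    define P where "P t e = (if e \<in> C then block_power C N t a e else 0)" for t e
    define H where "H i c e = (\<Sum>d\<in>D. N c d * X i d e)" for i c e
    define V where "V c t e = (\<Sum>j\<le>t. block_power C N j a c * H (t - j) c e)" for c t e
    have P0: "0 \<le> P t e" for t e
      by (simp add: P_def block_power_nonneg nonneg)
    have H0: "0 \<le> H i c e" for i c e
      unfolding H_def by (intro sum_nonneg mult_nonneg_nonneg nonneg X0)
    have V0: "0 \<le> V c t e" for c t e
      unfolding V_def by (intro sum_nonneg mult_nonneg_nonneg block_power_nonneg nonneg H0)
    have X_Suc: "X (Suc t) a e = P (Suc t) e + (\<Sum>c\<in>C. V c t e)" for t e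
    proof -
      have "X (Suc t) a e = P (Suc t) e
          + (\<Sum>j<Suc t. \<Sum>c\<in>C. block_power C N j a c * H (Suc t - Suc j) c e)"
        unfolding X_def P_def H_def by (rule block_power_decomposition[OF disj supp a])
      also have "(\<Sum>j<Suc t. \<Sum>c\<in>C. block_power C N j a c * H (Suc t - Suc j) c e) = (\<Sum>c\<in>C. V c t e)"
        unfolding V_def lessThan_Suc_atMost diff_Suc_Suc by (rule sum.swap)
      finally show ?thesis .
    qed
    have P_growth: "has_growth (\<lambda>t. P (Suc t)) 0 \<kappa> (\<lambda>e. if e \<in> C then \<kappa> * p a e else 0)"
      unfolding has_growth_def
    proof (intro conjI allI \<kappa>)
      fix e
      show "(\<lambda>t. P (Suc t) e / growth 0 \<kappa> t) \<longlonglongrightarrow> (if e \<in> C then \<kappa> * p a e else 0)"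
      proof (cases "e \<in> C")
        case True
        have "(\<lambda>t. \<kappa> * (block_power C N (Suc t) a e / \<kappa> ^ Suc t)) \<longlonglongrightarrow> \<kappa> * p a e"
          by (intro tendsto_mult tendsto_const LIMSEQ_Suc p_lim[OF a True])
        then show ?thesis
          using True \<kappa> by (simp add: growth_0 P_def del: block_power.simps)
      qed (simp add: P_def)
    qed
    have P_lim: "(\<lambda>t. P (Suc t) a / growth 0 \<kappa> t) \<longlonglongrightarrow> \<kappa> * p a a"
      using P_growth a unfolding has_growth_def by presburger
    show ?thesis
    proof (cases "D = {}")
      case True
      have "V c t e = 0" for c t e by (simp add: V_def H_def True)
      then have X_P: "X (Suc t) a e = P (Suc t) e" for t e by (simp add: X_Suc)
      have "convergent (\<lambda>t. X (Suc t) a e / growth 0 \<kappa> t)" for e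
        using P_growth by (auto simp: has_growth_def X_P intro: convergentI)
      then show ?thesis
        using has_growth_of_lower_bound[OF \<kappa>, of "\<lambda>t. X t a" 0 "\<lambda>t. P (Suc t) a" a "\<kappa> * p a a"]
          P_lim \<kappa> p[OF a a] X_P
        unfolding X_def by (metis mult_pos_pos order_refl)
    next
      case False
      then obtain k \<rho> v d\<^sub>0 e\<^sub>0 where \<rho>: "0 < \<rho>"
        and v: "\<And>d e. d \<in> D \<Longrightarrow> (\<lambda>t. X t d e / growth k \<rho> t) \<longlonglongrightarrow> v d e"
        and d0: "d\<^sub>0 \<in> D" "0 < v d\<^sub>0 e\<^sub>0"
        using growth_D by metis
      have v0: "0 \<le> v d e" if "d \<in> D" for d e
        using v[OF that, of e] \<rho>
        by (intro LIMSEQ_le_const) (auto intro!: divide_nonneg_pos X0 growth_pos)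
      have Nd0: "0 < N a d\<^sub>0" using d0 by (simp add: D_def)
      define h where "h c e = (\<Sum>d\<in>D. N c d * v d e)" for c e
      have H_lim: "(\<lambda>t. H t c e / growth k \<rho> t) \<longlonglongrightarrow> h c e" for c e
      proof -
        have "(\<lambda>t. \<Sum>d\<in>D. N c d * (X t d e / growth k \<rho> t)) \<longlonglongrightarrow> h c e"
          unfolding h_def by (intro tendsto_sum tendsto_mult tendsto_const v)
        then show ?thesis by (simp add: H_def sum_divide_distrib)
      qed
      have h0: "0 < h a e\<^sub>0"
        unfolding h_def by (rule sum_pos2[of _ d\<^sub>0]) (use d0 Nd0 v0 nonneg in auto)
      have conv: "convergent (\<lambda>t. X (Suc t) a e / growth k' \<rho>' t)"
        if "0 < \<rho>'" "\<kappa> < \<rho>' \<or> \<kappa> = \<rho>'"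
          and V: "\<And>c. c \<in> C \<Longrightarrow> convergent (\<lambda>t. V c t e / growth k' \<rho>' t)" for e k' \<rho>'
      proof -
        have "\<exists>v. has_growth (\<lambda>t. P (Suc t)) k' \<rho>' v"
        proof (cases "\<kappa> = \<rho>' \<and> k' = 0")
          case True
          then show ?thesis using P_growth by auto
        next
          case False
          then have "\<kappa> < \<rho>' \<or> \<kappa> = \<rho>' \<and> 0 < k'" using that by auto
          then show ?thesis using has_growth_faster[OF P_growth \<open>0 < \<rho>'\<close>] by auto
        qed
        then have "convergent (\<lambda>t. P (Suc t) e / growth k' \<rho>' t)"
          by (auto simp: has_growth_def convergent_def)
        then have "convergent (\<lambda>t. P (Suc t) e / growth k' \<rho>' t + (\<Sum>c\<in>C. V c t e / growth k' \<rho>' t))"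
          by (intro convergent_add convergent_sum V)
        then show ?thesis by (simp add: X_Suc add_divide_distrib sum_divide_distrib)
      qed
      have block_lim: "(\<lambda>t. block_power C N t a c / growth 0 \<kappa> t) \<longlonglongrightarrow> p a c" if "c \<in> C" for c
        using p_lim[OF a that] by (simp add: growth_0)
      \<comment> \<open>the indices in \<open>D\<close> dominate, both rates agree, or the block itself dominates\<close>
      consider "\<kappa> < \<rho>" | "\<kappa> = \<rho>" | "\<rho> < \<kappa>" by linarith
      then show ?thesis
      proof cases
        case 1
        have "convergent (\<lambda>t. V c t e / growth k \<rho> t)" if "c \<in> C" for c e
          unfolding V_def
          by (intro convolution_slower[OF \<rho> _ H_lim] summable_of_slower_growth[OF \<kappa> 1 block_lim[OF that]])
        then have "convergent (\<lambda>t. X (Suc t) a e / growth k \<rho> t)" for e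
          using 1 \<rho> by (intro conv) auto
        moreover have "(\<lambda>t. N a d\<^sub>0 * X t d\<^sub>0 e\<^sub>0 / growth k \<rho> t) \<longlonglongrightarrow> N a d\<^sub>0 * v d\<^sub>0 e\<^sub>0"
          using tendsto_mult[OF tendsto_const v[OF d0(1), of e\<^sub>0], of "N a d\<^sub>0"] by simp
        moreover have "0 < N a d\<^sub>0 * v d\<^sub>0 e\<^sub>0" using d0 Nd0 by simp
        ultimately show ?thesis
          using has_growth_of_lower_bound[OF \<rho>, of "\<lambda>t. X t a" k "\<lambda>t. N a d\<^sub>0 * X t d\<^sub>0 e\<^sub>0" e\<^sub>0] X_ge
          unfolding X_def by metis
      next
        case 2
        have V_lim: "(\<lambda>t. V c t e / growth (Suc k) \<rho> t) \<longlonglongrightarrow> p a c * h c e / real (Suc k)"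
          if "c \<in> C" for c e
          unfolding V_def by (rule convolution_resonant[OF \<rho> _ H_lim]) (use p_lim[OF a that] 2 in simp)
        then have "convergent (\<lambda>t. X (Suc t) a e / growth (Suc k) \<rho> t)" for e
          using 2 \<rho> by (intro conv) (auto simp: convergent_def)
        moreover have "V a t e\<^sub>0 \<le> X (Suc t) a e\<^sub>0" for t
          unfolding X_Suc using P0[of "Suc t" e\<^sub>0] member_le_sum[of a C "\<lambda>c. V c t e\<^sub>0"] V0 a by auto
        moreover have "0 < p a a * h a e\<^sub>0 / real (Suc k)"
          using p[OF a a] h0 by simp
        ultimately show ?thesis
          using has_growth_of_lower_bound[OF \<rho>, of "\<lambda>t. X t a" "Suc k" "\<lambda>t. V a t e\<^sub>0" e\<^sub>0] V_lim[OF a]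
          unfolding X_def by metis
      next
        case 3
        have "convergent (\<lambda>t. V c t e / growth 0 \<kappa> t)" if "c \<in> C" for c e
        proof -
          have "V c t e = (\<Sum>j\<le>t. H j c e * block_power C N (t - j) a c)" for t
            unfolding V_def
            by (rule sum.reindex_bij_witness[of _ "\<lambda>j. t - j" "\<lambda>j. t - j"]) auto
          then show ?thesis
            using convolution_slower[OF \<kappa> summable_of_slower_growth[OF \<rho> 3 H_lim[of c e]] block_lim[OF that]]
            by simp
        qed
        then have "convergent (\<lambda>t. X (Suc t) a e / growth 0 \<kappa> t)" for e
          using \<kappa> by (intro conv) auto
        moreover have "P (Suc t) a \<le> X (Suc t) a a" for t
          unfolding X_Suc by (simp add: sum_nonneg V0)
        moreover note P_lim
        moreover have "0 < \<kappa> * p a a" using \<kappa> p[OF a a] by simp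
        ultimately show ?thesis
          using has_growth_of_lower_bound[OF \<kappa>, of "\<lambda>t. X t a" 0 "\<lambda>t. P (Suc t) a" a]
          unfolding X_def by metis
      qed
    qed
  qed
qed

section \<open>Letter frequencies of an expanding substitution\<close>

lemma sum_list_count:
  fixes f :: "'a::finite \<Rightarrow> 'b::semiring_1"
  shows "sum_list (map f u) = (\<Sum>c\<in>UNIV. of_nat (count_list u c) * f c)"
proof (induction u)
  case (Cons b u)
  have "of_nat (count_list (b # u) c) * f c = (if b = c then f c else 0) + of_nat (count_list u c) * f c" for c
    by (simp add: distrib_right)
  then show ?case using Cons by (simp add: sum.distrib del: count_list.simps)
qed simp

lemma length_eq_sum_count: "length u = (\<Sum>c::'a::finite\<in>UNIV. count_list u c)"
proof -
  have "length u = sum_list (map (\<lambda>_. 1) u)" by (induction u) auto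
  also have "\<dots> = (\<Sum>c\<in>UNIV. count_list u c)"
    unfolding sum_list_count by simp
  finally show ?thesis .
qed

lemma subst_ext_funpow: "(subst_ext \<zeta> ^^ t) u = concat (map (subst_iter \<zeta> t) u)"
proof (induction t arbitrary: u)
  case 0
  then show ?case by (simp add: subst_iter_def)
next
  case (Suc t)
  have "(subst_ext \<zeta> ^^ Suc t) u = concat (map (subst_iter \<zeta> t) (concat (map \<zeta> u)))"
    by (simp add: funpow_Suc_right Suc subst_ext_def del: funpow.simps)
  also have "\<dots> = concat (map (\<lambda>b. concat (map (subst_iter \<zeta> t) (\<zeta> b))) u)"
    by (induction u) auto
  also have "(\<lambda>b. concat (map (subst_iter \<zeta> t) (\<zeta> b))) = subst_iter \<zeta> (Suc t)"
  proof
    fix b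
    have "subst_iter \<zeta> (Suc t) b = (subst_ext \<zeta> ^^ t) (subst_ext \<zeta> [b])"
      unfolding subst_iter_def by (simp only: funpow_Suc_right comp_apply)
    then show "concat (map (subst_iter \<zeta> t) (\<zeta> b)) = subst_iter \<zeta> (Suc t) b"
      by (simp only: Suc) (simp add: subst_ext_def)
  qed
  finally show ?case .
qed

lemma subst_iter_0 [simp]: "subst_iter \<zeta> 0 b = [b]"
  by (simp add: subst_iter_def)

lemma subst_iter_1 [simp]: "subst_iter \<zeta> (Suc 0) = \<zeta>"
  by (simp add: fun_eq_iff subst_iter_def subst_ext_def)

lemma subst_iter_add: "subst_iter \<zeta> (t + r) b = concat (map (subst_iter \<zeta> r) (subst_iter \<zeta> t b))"
  unfolding subst_ext_funpow[symmetric]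
  by (simp only: subst_iter_def add.commute[of t r] funpow_add comp_apply)

lemma subst_iter_Suc: "subst_iter \<zeta> (Suc t) b = concat (map (subst_iter \<zeta> t) (\<zeta> b))"
  using subst_iter_add[of \<zeta> 1 t b] by simp

lemma subst_iter_power: "subst_iter (subst_iter \<zeta> s) t = subst_iter \<zeta> (s * t)"
proof (induction t)
  case (Suc t)
  show ?case by (rule ext) (simp add: subst_iter_Suc subst_iter_add Suc)
qed (simp add: fun_eq_iff)

lemma length_concat_ge:
  assumes "\<And>c. m \<le> length (f c)"
  shows "m * length u \<le> length (concat (map f u))"
  using assms by (induction u) (auto simp: add_mono)

text \<open>A letter with empty image has empty image under all higher powers as well.\<close>

lemma expanding_nonerasing:
  assumes "expanding \<zeta>"
  shows "\<zeta> b \<noteq> []"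
proof
  assume "\<zeta> b = []"
  obtain k where k: "1 \<le> k" "2 \<le> length (subst_iter \<zeta> k b)"
    using assms by (auto simp: expanding_def)
  then obtain j where "k = Suc j" by (cases k) auto
  then show False using k \<open>\<zeta> b = []\<close> by (simp add: subst_iter_Suc)
qed

lemma expanding_length_mono:
  assumes "expanding \<zeta>" "t \<le> t'"
  shows "length (subst_iter \<zeta> t b) \<le> length (subst_iter \<zeta> t' b)"
  using assms(2)
proof (induction rule: dec_induct)
  case (step n)
  have "1 * length (subst_iter \<zeta> n b) \<le> length (concat (map \<zeta> (subst_iter \<zeta> n b)))"
    by (rule length_concat_ge) (simp add: Suc_le_eq expanding_nonerasing[OF assms(1)])
  also have "concat (map \<zeta> (subst_iter \<zeta> n b)) = subst_iter \<zeta> (Suc n) b"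
    using subst_iter_add[of \<zeta> n 1 b] by simp
  finally show ?case using step by simp
qed simp

text \<open>Lengths double every \<open>k\<close> steps and never decrease in between.\<close>

lemma expanding_length_unbounded:
  assumes "expanding \<zeta>"
  shows "\<exists>r\<^sub>0. \<forall>r\<ge>r\<^sub>0. \<forall>b. m \<le> length (subst_iter \<zeta> r b)"
proof -
  obtain k where k: "1 \<le> k" "\<And>b. 2 \<le> length (subst_iter \<zeta> k b)"
    using assms by (auto simp: expanding_def)
  have pow: "2 ^ n \<le> length (subst_iter \<zeta> (k * n) b)" for n b
  proof (induction n)
    case (Suc n)
    have "2 * 2 ^ n \<le> 2 * length (subst_iter \<zeta> (k * n) b)"
      using Suc by simp
    also have "\<dots> \<le> length (concat (map (subst_iter \<zeta> k) (subst_iter \<zeta> (k * n) b)))"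
      by (rule length_concat_ge[OF k(2)])
    also have "\<dots> = length (subst_iter \<zeta> (k * Suc n) b)"
      by (simp add: add.commute[of k] flip: subst_iter_add)
    finally show ?case by simp
  qed simp
  show ?thesis
  proof (intro exI[of _ "k * m"] allI impI)
    fix r b assume "k * m \<le> r"
    then have "length (subst_iter \<zeta> (k * m) b) \<le> length (subst_iter \<zeta> r b)"
      by (rule expanding_length_mono[OF assms])
    moreover have "m < 2 ^ m" by (rule less_exp)
    ultimately show "m \<le> length (subst_iter \<zeta> r b)" using pow[of m b] by linarith
  qed
qed

lemma expanding_power:
  assumes "expanding \<zeta>" "1 \<le> s"
  shows "expanding (subst_iter \<zeta> s)"
proof -
  obtain r\<^sub>0 where r0: "\<And>r b. r\<^sub>0 \<le> r \<Longrightarrow> 2 \<le> length (subst_iter \<zeta> r b)"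
    using expanding_length_unbounded[OF assms(1), of 2] by blast
  have "r\<^sub>0 \<le> s * Suc r\<^sub>0" using assms(2) by (metis Suc_leD mult_le_mono1 nat_mult_1)
  then show ?thesis
    unfolding expanding_def subst_iter_power using r0 by (intro exI[of _ "Suc r\<^sub>0"]) auto
qed

text \<open>A sequence in a finite set whose future is determined by its present is eventually
  periodic. If \<open>s\<close> is a multiple of the period and lies beyond the preperiod, then \<open>s\<close> and
  \<open>s + s\<close> have the same value.\<close>

lemma finite_orbit_idempotent:
  fixes f :: "nat \<Rightarrow> 'b::finite"
  assumes "\<And>m n k. f m = f n \<Longrightarrow> f (m + k) = f (n + k)"
  shows "\<exists>s\<ge>1. f (s + s) = f s"
proof -
  have "\<not> inj f" by (metis finite infinite_UNIV_nat finite_imageD finite_subset subset_UNIV)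
  then obtain i j where "f i = f j" "i < j"
    unfolding inj_def by (metis linorder_neqE_nat)
  define p where "p = j - i"
  have period: "f (n + p) = f n" if "i \<le> n" for n
    using assms[OF \<open>f i = f j\<close>, of "n - i"] that \<open>i < j\<close> by (simp add: p_def add.commute)
  have periods: "f (n + p * q) = f n" if "i \<le> n" for n q
  proof (induction q)
    case (Suc q)
    then show ?case using period[of "n + p * q"] that by (simp add: ac_simps)
  qed simp
  have "Suc i \<le> p * Suc i"
    using \<open>i < j\<close> mult_le_mono1[of 1 p "Suc i"] by (simp add: p_def)
  then have "i \<le> p * Suc i" "1 \<le> p * Suc i" by linarith+
  then show ?thesis using periods by blast
qed

text \<open>The relation that \<open>c\<close> occurs in the image of \<open>b\<close> under a power of \<open>\<zeta>\<close> is the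
  corresponding power of a relation on a finite set, and every element of a finite semigroup
  has an idempotent power. Passing to this power removes all periodicity at once.\<close>

lemma subst_power_transitive:
  fixes \<zeta> :: "'a::finite \<Rightarrow> 'a list"
  shows "\<exists>s\<ge>1. \<forall>b c d. c \<in> set (subst_iter \<zeta> s b) \<longrightarrow> d \<in> set (subst_iter \<zeta> s c)
    \<longrightarrow> d \<in> set (subst_iter \<zeta> s b)"
proof -
  define S where "S t = {(b, c). c \<in> set (subst_iter \<zeta> t b)}" for t
  have S_add: "S (t + r) = S t O S r" for t r
    by (auto simp: S_def subst_iter_add)
  obtain s where s: "1 \<le> s" "S (s + s) = S s"
    using finite_orbit_idempotent[of S] S_add by auto
  show ?thesis
  proof (intro exI[of _ s] conjI allI impI s(1))
    fix b c d assume "c \<in> set (subst_iter \<zeta> s b)" "d \<in> set (subst_iter \<zeta> s c)"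
    then have "(b, d) \<in> S s O S s" by (auto simp: S_def)
    then show "d \<in> set (subst_iter \<zeta> s b)" using s(2) S_add[of s s] by (simp add: S_def)
  qed
qed

lemma count_subst_iter:
  fixes \<sigma> :: "'a::finite \<Rightarrow> 'a list"
  shows "block_power UNIV (\<lambda>b c. real (count_list (\<sigma> b) c)) t b e = real (count_list (subst_iter \<sigma> t b) e)"
proof (induction t arbitrary: b)
  case 0
  then show ?case by auto
next
  case (Suc t)
  have "count_list (concat (map f u)) e = sum_list (map (\<lambda>c. count_list (f c) e) u)"
    for f :: "'a \<Rightarrow> 'a list" and u
    by (induction u) auto
  then show ?case
    by (simp add: Suc subst_iter_Suc sum_list_count)
qed

text \<open>The letter counts and their sum, the length, grow on the same scale, so their quotients
  converge. The limit vector is nonzero and nonnegative, so the limit of the length does not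
  vanish.\<close>

lemma letter_frequencies_converge:
  fixes \<sigma> :: "'a::finite \<Rightarrow> 'a list"
  assumes nonerasing: "\<And>b. \<sigma> b \<noteq> []"
    and trans: "\<And>b c d. c \<in> set (\<sigma> b) \<Longrightarrow> d \<in> set (\<sigma> c) \<Longrightarrow> d \<in> set (\<sigma> b)"
  shows "\<exists>p. \<forall>c. (\<lambda>t. real (count_list (subst_iter \<sigma> t a) c) / real (length (subst_iter \<sigma> t a)))
    \<longlonglongrightarrow> p c"
proof -
  define x where "x t e = real (count_list (subst_iter \<sigma> t a) e)" for t e
  have count_pos: "0 < real (count_list u c) \<longleftrightarrow> c \<in> set u" for u :: "'a list" and c
    by (simp add: count_list_0_iff zero_less_iff_neq_zero del: gr0_conv_Suc)
  have "\<exists>c. c \<in> set (\<sigma> b)" for b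
    using nonerasing[of b] by (metis list.set_intros(1) neq_Nil_conv)
  then obtain k \<rho> v where "has_growth (\<lambda>t e. block_power UNIV (\<lambda>b c. real (count_list (\<sigma> b) c)) t a e) k \<rho> v"
    and e: "\<exists>e. v e \<noteq> 0"
    using transitive_matrix_growth[of "\<lambda>b c. real (count_list (\<sigma> b) c)" a] trans
    unfolding count_pos by (metis of_nat_0_le_iff)
  then have \<rho>: "0 < \<rho>" and v: "\<And>e. (\<lambda>t. x t e / growth k \<rho> t) \<longlonglongrightarrow> v e"
    by (auto simp: has_growth_def count_subst_iter x_def)
  have v0: "0 \<le> v e" for e
    using v[of e] by (rule LIMSEQ_le_const)
      (auto intro!: exI[of _ 0] divide_nonneg_pos growth_pos[OF \<rho>] simp: x_def)
  define V where "V = (\<Sum>e\<in>UNIV. v e)"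
  have V: "0 < V"
    using e v0 unfolding V_def by (metis UNIV_I finite order_le_less sum_pos2)
  have "(\<lambda>t. \<Sum>e\<in>UNIV. x t e / growth k \<rho> t) \<longlonglongrightarrow> V"
    unfolding V_def by (intro tendsto_sum v)
  moreover have "(\<Sum>e\<in>UNIV. x t e / growth k \<rho> t) = real (length (subst_iter \<sigma> t a)) / growth k \<rho> t" for t
    by (simp add: x_def length_eq_sum_count sum_divide_distrib)
  ultimately have len: "(\<lambda>t. real (length (subst_iter \<sigma> t a)) / growth k \<rho> t) \<longlonglongrightarrow> V"
    by simp
  have "(\<lambda>t. x t c / real (length (subst_iter \<sigma> t a))) \<longlonglongrightarrow> v c / V" for c
    using tendsto_divide[OF v[of c] len] V growth_pos[OF \<rho>, of k]
    by (simp add: less_imp_neq[symmetric])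
  then show ?thesis unfolding x_def by (intro exI[of _ "\<lambda>c. v c / V"] allI)
qed

section \<open>Frequencies of words\<close>

lemma occurrences_nth:
  "occurrences w u = card {i. i + length w \<le> length u \<and> (\<forall>j<length w. u ! (i + j) = w ! j)}"
proof -
  have "take (length w) (drop i u) = w \<longleftrightarrow> (\<forall>j<length w. u ! (i + j) = w ! j)"
    if "i + length w \<le> length u" for i
    using that by (simp add: list_eq_iff_nth_eq)
  then show ?thesis
    unfolding occurrences_def by (intro arg_cong[where f = card] Collect_cong) auto
qed

lemma finite_positions [simp]: "finite {i. i + length w \<le> length (u :: 'a list) \<and> P i}"
  by (rule finite_subset[of _ "{..length u}"]) auto

text \<open>An occurrence in \<open>u @ v\<close> lies in \<open>u\<close>, or in \<open>v\<close>, or it straddles the seam, for which it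
  must start among the last \<open>length w\<close> positions of \<open>u\<close>.\<close>

lemma occurrences_append:
  assumes "w \<noteq> []"
  shows "occurrences w u + occurrences w v \<le> occurrences w (u @ v)"
    and "occurrences w (u @ v) \<le> occurrences w u + occurrences w v + length w"
proof -
  define occ where "occ x = {i. i + length w \<le> length x \<and> (\<forall>j<length w. x ! (i + j) = w ! j)}" for x
  define L where "L = {i. i + length w \<le> length u}"
  define B where "B = occ (u @ v) - L - {length u..}"
  have fin: "finite (occ x)" for x by (simp add: occ_def)
  have left: "occ (u @ v) \<inter> L = occ u"
    using assms by (auto simp: occ_def L_def nth_append)
  have right: "occ (u @ v) \<inter> {length u..} = (+) (length u) ` occ v"
  proof safe
    fix i assume i: "i \<in> occ (u @ v)" "length u \<le> i"
    then have "i - length u \<in> occ v"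
      by (auto simp: occ_def nth_append)
    then show "i \<in> (+) (length u) ` occ v" using i(2) by (intro image_eqI[of _ _ "i - length u"]) auto
  qed (auto simp: occ_def nth_append add.assoc)
  have "card B \<le> card {length u - length w..<length u}"
    by (rule card_mono) (auto simp: B_def L_def)
  then have B: "card B \<le> length w" by simp
  have "occ (u @ v) = (occ u \<union> (+) (length u) ` occ v) \<union> B"
    unfolding left[symmetric] right[symmetric] B_def by blast
  also have "card \<dots> = card (occ u \<union> (+) (length u) ` occ v) + card B"
    unfolding left[symmetric] right[symmetric] B_def by (rule card_Un_disjoint) (use fin in auto)
  also have "card (occ u \<union> (+) (length u) ` occ v) = card (occ u) + card ((+) (length u) ` occ v)"
    using assms fin by (intro card_Un_disjoint) (auto simp: occ_def)
  also have "card ((+) (length u) ` occ v) = card (occ v)"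
    by (rule card_image) simp
  finally have "occurrences w (u @ v) = occurrences w u + occurrences w v + card B"
    by (simp add: occurrences_nth occ_def)
  then show "occurrences w u + occurrences w v \<le> occurrences w (u @ v)"
    "occurrences w (u @ v) \<le> occurrences w u + occurrences w v + length w"
    using B by auto
qed

lemma occurrences_concat:
  assumes "w \<noteq> []"
  shows "sum_list (map (occurrences w) us) \<le> occurrences w (concat us)"
    and "occurrences w (concat us) \<le> sum_list (map (occurrences w) us) + length w * length us"
proof -
  have "occurrences w [] = 0" using assms by (simp add: occurrences_def)
  then show "sum_list (map (occurrences w) us) \<le> occurrences w (concat us)"
    by (induction us) (auto intro: order_trans[OF _ occurrences_append(1)[OF assms]])
  show "occurrences w (concat us) \<le> sum_list (map (occurrences w) us) + length w * length us"
  proof (induction us)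
    case (Cons u us)
    then show ?case using occurrences_append(2)[OF assms, of u "concat us"] by simp
  qed (simp add: \<open>occurrences w [] = 0\<close>)
qed

text \<open>Cut \<open>\<sigma> ^ (t + r)\<close> of \<open>a\<close> into the images under \<open>\<sigma> ^ r\<close> of the letters of \<open>\<sigma> ^ t\<close> of \<open>a\<close>.
  Apart from occurrences that straddle a cut, the frequency of \<open>w\<close> is a function of the letter
  frequencies at time \<open>t\<close>, and so converges as \<open>t\<close> grows. There are at most \<open>length w\<close>
  straddling occurrences per piece, and expansion makes all pieces long for large \<open>r\<close>. Thus the
  frequencies of \<open>w\<close> form a Cauchy sequence.\<close>

lemma word_frequency_converges:
  fixes \<sigma> :: "'a::finite \<Rightarrow> 'a list"
  assumes exp: "expanding \<sigma>" and w: "w \<noteq> []"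
    and p: "\<And>c. (\<lambda>t. real (count_list (subst_iter \<sigma> t a) c) / real (length (subst_iter \<sigma> t a))) \<longlonglongrightarrow> p c"
  shows "convergent (\<lambda>t. real (occurrences w (subst_iter \<sigma> t a)) / real (length (subst_iter \<sigma> t a)))"
proof -
  define n where "n t = real (length (subst_iter \<sigma> t a))" for t
  define x where "x t c = real (count_list (subst_iter \<sigma> t a) c)" for t c
  define F where "F t = real (occurrences w (subst_iter \<sigma> t a)) / n t" for t
  have n: "1 \<le> n t" for t
    using expanding_length_mono[OF exp, of 0 t a] by (simp add: n_def Suc_le_eq)
  have sum_p: "(\<Sum>c\<in>UNIV. p c) = 1"
  proof (rule LIMSEQ_unique)
    show "(\<lambda>t. \<Sum>c\<in>UNIV. x t c / n t) \<longlonglongrightarrow> (\<Sum>c\<in>UNIV. p c)"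
      unfolding x_def n_def by (intro tendsto_sum p)
    have "(\<Sum>c\<in>UNIV. x t c / n t) = n t / n t" for t
      by (simp add: x_def n_def length_eq_sum_count flip: sum_divide_distrib)
    then show "(\<lambda>t. \<Sum>c\<in>UNIV. x t c / n t) \<longlonglongrightarrow> 1"
      using n by (simp add: less_imp_neq[symmetric] order_less_le_trans[OF zero_less_one])
  qed
  have p0: "0 \<le> p c" for c
    using p[of c] by (rule LIMSEQ_le_const) auto
  have approx: "\<exists>\<alpha> r. \<forall>\<^sub>F t in sequentially. \<bar>F (t + r) - \<alpha>\<bar> < e" if e: "0 < e" for e
  proof -
    \<comment> \<open>\<open>length w / m\<close> bounds the share of straddling occurrences\<close>
    obtain m :: nat where m: "length w / (e / 2) < m" using reals_Archimedean2 by blast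
    have m0: "0 < m" using m e by (metis divide_nonneg_pos half_gt_zero not_less of_nat_0_le_iff of_nat_0_less_iff order_le_less_trans)
    obtain r where r: "\<And>b. m \<le> length (subst_iter \<sigma> r b)"
      using expanding_length_unbounded[OF exp, of m] by blast
    define l where "l c = real (length (subst_iter \<sigma> r c))" for c
    define q where "q c = real (occurrences w (subst_iter \<sigma> r c))" for c
    define A where "A t = (\<Sum>c\<in>UNIV. x t c / n t * q c) / (\<Sum>c\<in>UNIV. x t c / n t * l c)" for t
    define \<alpha> where "\<alpha> = (\<Sum>c\<in>UNIV. p c * q c) / (\<Sum>c\<in>UNIV. p c * l c)"
    have l: "real m \<le> l c" for c using r by (simp add: l_def)
    have "real m = (\<Sum>c\<in>UNIV. p c * real m)"
      using sum_p by (simp flip: sum_distrib_right)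
    also have "\<dots> \<le> (\<Sum>c\<in>UNIV. p c * l c)"
      by (intro sum_mono mult_left_mono l p0)
    finally have den: "(\<Sum>c\<in>UNIV. p c * l c) \<noteq> 0" using m0 by linarith
    have A_lim: "A \<longlonglongrightarrow> \<alpha>"
      unfolding A_def \<alpha>_def x_def n_def
      by (intro tendsto_divide tendsto_sum tendsto_mult tendsto_const p den)
    \<comment> \<open>\<open>A t\<close> is the frequency with the straddling occurrences left out\<close>
    have close: "\<bar>F (t + r) - A t\<bar> < e / 2" for t
    proof -
      let ?u = "subst_iter \<sigma> t a"
      let ?O = "\<Sum>c\<in>UNIV. x t c * q c"
      let ?L = "\<Sum>c\<in>UNIV. x t c * l c"
      have iter: "subst_iter \<sigma> (t + r) a = concat (map (subst_iter \<sigma> r) ?u)"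
        by (rule subst_iter_add)
      have "real (sum_list (map (occurrences w) (map (subst_iter \<sigma> r) ?u))) = ?O"
        by (simp add: q_def x_def comp_def sum_list_count)
      then have O: "?O \<le> real (occurrences w (subst_iter \<sigma> (t + r) a))"
        "real (occurrences w (subst_iter \<sigma> (t + r) a)) \<le> ?O + length w * n t"
        using occurrences_concat[OF w, of "map (subst_iter \<sigma> r) ?u"]
        unfolding iter n_def by (simp_all flip: of_nat_le_iff[where 'a=real])
      have L: "n (t + r) = ?L"
        by (simp add: n_def iter length_concat l_def x_def comp_def sum_list_count)
      have "n t * real m = (\<Sum>c\<in>UNIV. x t c * real m)"
        by (simp add: n_def x_def length_eq_sum_count flip: sum_distrib_right)
      also have "\<dots> \<le> ?L" by (intro sum_mono mult_left_mono l) (simp add: x_def)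
      finally have L_ge: "n t * real m \<le> ?L" .
      have nm: "0 < n t * real m" using n[of t] m0 by simp
      have "A t = (?O / n t) / (?L / n t)"
        unfolding A_def by (simp add: sum_divide_distrib)
      also have "\<dots> = ?O / ?L" using n[of t] by simp
      finally have "F (t + r) - A t = (real (occurrences w (subst_iter \<sigma> (t + r) a)) - ?O) / ?L"
        by (simp add: F_def L diff_divide_distrib)
      then have "\<bar>F (t + r) - A t\<bar> = (real (occurrences w (subst_iter \<sigma> (t + r) a)) - ?O) / ?L"
        using O L_ge nm by simp
      also have "\<dots> \<le> (length w * n t) / (n t * real m)"
        using O L_ge nm by (intro frac_le) auto
      also have "\<dots> = length w / real m" using n[of t] by simp
      also have "\<dots> < e / 2" using m e m0 by (simp add: field_simps)
      finally show ?thesis .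
    qed
    have "\<forall>\<^sub>F t in sequentially. dist (A t) \<alpha> < e / 2"
      using A_lim e by (intro tendstoD) auto
    then have "\<forall>\<^sub>F t in sequentially. \<bar>F (t + r) - \<alpha>\<bar> < e"
    proof eventually_elim
      case (elim t)
      then show ?case using close[of t] unfolding dist_real_def by linarith
    qed
    then show ?thesis by blast
  qed
  have "Cauchy F"
  proof (rule CauchyI)
    fix e :: real assume "0 < e"
    then obtain \<alpha> r N where N: "\<And>t. N \<le> t \<Longrightarrow> \<bar>F (t + r) - \<alpha>\<bar> < e / 2"
      using approx[of "e / 2"] unfolding eventually_sequentially by auto
    show "\<exists>M. \<forall>m\<ge>M. \<forall>n\<ge>M. norm (F m - F n) < e"
    proof (intro exI[of _ "N + r"] allI impI)
      fix i j assume "N + r \<le> i" "N + r \<le> j"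
      then have "\<bar>F i - \<alpha>\<bar> < e / 2" "\<bar>F j - \<alpha>\<bar> < e / 2"
        using N[of "i - r"] N[of "j - r"] by auto
      then show "norm (F i - F j) < e" by (simp add: abs_if split: if_splits)
    qed
  qed
  then show ?thesis
    by (simp add: F_def[abs_def] n_def Cauchy_convergent_iff)
qed

theorem frequencies_converge_power:
  fixes \<zeta> :: "'a::finite \<Rightarrow> 'a list"
  assumes "expanding \<zeta>"
  shows "\<exists>s\<ge>1. \<forall>b. freqs_converge \<zeta> s b"
proof -
  obtain s where s: "1 \<le> s" and trans: "\<And>b c d. c \<in> set (subst_iter \<zeta> s b) \<Longrightarrow>
      d \<in> set (subst_iter \<zeta> s c) \<Longrightarrow> d \<in> set (subst_iter \<zeta> s b)"
    using subst_power_transitive[of \<zeta>] by blast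
  have exp: "expanding (subst_iter \<zeta> s)" by (rule expanding_power[OF assms s])
  have "convergent (subst_freq \<zeta> s b w)" if w: "w \<noteq> []" for b w
  proof -
    obtain p where p: "\<And>c. (\<lambda>t. real (count_list (subst_iter (subst_iter \<zeta> s) t b) c)
        / real (length (subst_iter (subst_iter \<zeta> s) t b))) \<longlonglongrightarrow> p c"
      using letter_frequencies_converge[of "subst_iter \<zeta> s" b] expanding_nonerasing[OF exp] trans by metis
    show ?thesis
      using word_frequency_converges[OF exp w p] by (simp add: subst_iter_power subst_freq_def[abs_def])
  qed
  then show ?thesis using s by (auto simp: freqs_converge_def)
qed

lemma card_eq_sum_fibres:
  fixes g :: "'b \<Rightarrow> 'a::finite"
  assumes "finite S"
  shows "card S = (\<Sum>c\<in>UNIV. card {i \<in> S. g i = c})"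
  using sum.group[of S UNIV g "\<lambda>_. 1 :: nat"] assms by simp

text \<open>Every occurrence of \<open>w\<close> extends to the right by exactly one letter, except possibly one
  at the very end of \<open>u\<close>. After division by a length that tends to infinity the exception
  disappears, which yields the consistency of the limit frequencies.\<close>

lemma occurrences_snoc:
  fixes u w :: "'a::finite list"
  shows "(\<Sum>c\<in>UNIV. occurrences (w @ [c]) u) \<le> occurrences w u"
    and "occurrences w u \<le> (\<Sum>c\<in>UNIV. occurrences (w @ [c]) u) + 1"
proof -
  define Q where "Q = {i. i + length w \<le> length u \<and> (\<forall>j<length w. u ! (i + j) = w ! j)}"
  define S where "S = {i \<in> Q. i + length w < length u}"
  have fin: "finite Q" "finite S" by (simp_all add: Q_def S_def)
  have "{i \<in> S. u ! (i + length w) = c} = {i. i + length (w @ [c]) \<le> length u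
      \<and> (\<forall>j<length (w @ [c]). u ! (i + j) = (w @ [c]) ! j)}" for c
    by (auto simp: S_def Q_def nth_append less_Suc_eq)
  then have sum: "(\<Sum>c\<in>UNIV. occurrences (w @ [c]) u) = card S"
    unfolding occurrences_nth card_eq_sum_fibres[OF fin(2), of "\<lambda>i. u ! (i + length w)"] by simp
  have occ: "occurrences w u = card Q" by (simp add: occurrences_nth Q_def)
  show "(\<Sum>c\<in>UNIV. occurrences (w @ [c]) u) \<le> occurrences w u"
    unfolding sum occ by (rule card_mono) (use fin in \<open>auto simp: S_def\<close>)
  have "Q \<subseteq> insert (length u - length w) S"
    by (auto simp: S_def Q_def)
  then have "card Q \<le> card (insert (length u - length w) S)"
    by (intro card_mono) (use fin in auto)
  then show "occurrences w u \<le> (\<Sum>c\<in>UNIV. occurrences (w @ [c]) u) + 1"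
    unfolding sum occ using card_insert_le_m1 card.insert_remove[OF fin(2)]
    by (metis Suc_eq_plus1 card_insert_if fin(2) le_SucI)
qed

text \<open>The mirror image: only an occurrence at position \<open>0\<close> cannot be extended to the left.\<close>

lemma occurrences_Cons:
  fixes u w :: "'a::finite list"
  shows "(\<Sum>c\<in>UNIV. occurrences (c # w) u) \<le> occurrences w u"
    and "occurrences w u \<le> (\<Sum>c\<in>UNIV. occurrences (c # w) u) + 1"
proof -
  define Q where "Q = {i. i + length w \<le> length u \<and> (\<forall>j<length w. u ! (i + j) = w ! j)}"
  define S where "S = {i. Suc i \<in> Q}"
  have fin: "finite Q" by (simp add: Q_def)
  have image: "Suc ` S = Q - {0}"
    unfolding S_def by (auto simp: image_iff) (metis not0_implies_Suc)
  then have finS: "finite S"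
    using fin by (metis finite_Diff finite_imageD inj_Suc inj_on_subset subset_UNIV)
  have card: "card S = card (Q - {0})"
    unfolding image[symmetric] by (simp add: card_image)
  have "{i \<in> S. u ! i = c} = {i. i + length (c # w) \<le> length u
      \<and> (\<forall>j<length (c # w). u ! (i + j) = (c # w) ! j)}" for c
    by (auto simp: S_def Q_def nth_Cons split: nat.splits)
  then have sum: "(\<Sum>c\<in>UNIV. occurrences (c # w) u) = card S"
    unfolding occurrences_nth card_eq_sum_fibres[OF finS, of "\<lambda>i. u ! i"] by simp
  have occ: "occurrences w u = card Q" by (simp add: occurrences_nth Q_def)
  show "(\<Sum>c\<in>UNIV. occurrences (c # w) u) \<le> occurrences w u"
    unfolding sum occ card by (rule card_mono) (use fin in auto)
  show "occurrences w u \<le> (\<Sum>c\<in>UNIV. occurrences (c # w) u) + 1"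
    unfolding sum occ card using diff_card_le_card_Diff[of "{0}" Q] by simp
qed

section \<open>Finitary sets and measures on the full shift\<close>

lemma factor_snoc: "biinf_factor y i (Suc n) = biinf_factor y i n @ [y (i + int n)]"
  by (simp add: biinf_factor_def)

lemma factor_Cons: "biinf_factor y (i - 1) (Suc n) = y (i - 1) # biinf_factor y i n"
  by (rule nth_equalityI) (auto simp: biinf_factor_def nth_Cons simp del: upt_Suc split: nat.splits)

lemma length_factor [simp]: "length (biinf_factor y i n) = n"
  by (simp add: biinf_factor_def)

lemma factor_eq_iff: "biinf_factor y i n = biinf_factor z i n \<longleftrightarrow> (\<forall>j. i \<le> j \<and> j < i + int n \<longrightarrow> y j = z j)"
proof
  assume eq: "biinf_factor y i n = biinf_factor z i n"
  show "\<forall>j. i \<le> j \<and> j < i + int n \<longrightarrow> y j = z j"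
  proof (intro allI impI)
    fix j assume "i \<le> j \<and> j < i + int n"
    then have "nat (j - i) < n" "i + int (nat (j - i)) = j" by auto
    then show "y j = z j"
      using arg_cong[OF eq, of "\<lambda>u. u ! nat (j - i)"] by (simp add: biinf_factor_def)
  qed
qed (auto simp: biinf_factor_def)

lemma ex_factor_eq: "\<exists>y. biinf_factor y i (length w) = w"
  by (intro exI[of _ "\<lambda>j. w ! nat (j - i)"] nth_equalityI) (auto simp: biinf_factor_def)

text \<open>Membership in \<open>A\<close> depends only on the letters at the positions \<open>i, \<dots>, i + n - 1\<close>. Unlike
  cylinders, such sets are closed under all Boolean operations, and the window may be
  enlarged freely, which brings any two of them into a common window.\<close>

definition window_determined :: "int \<Rightarrow> nat \<Rightarrow> (int \<Rightarrow> 'a) set \<Rightarrow> bool" where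
  "window_determined i n A \<longleftrightarrow>
     (\<forall>y z. biinf_factor y i n = biinf_factor z i n \<longrightarrow> y \<in> A \<longrightarrow> z \<in> A)"

lemma window_determined_mono:
  assumes "window_determined i n A" "i' \<le> i" "i + int n \<le> i' + int n'"
  shows "window_determined i' n' A"
  using assms unfolding window_determined_def factor_eq_iff by (smt (verit, best))

lemma window_determined_Un:
  "window_determined i n A \<Longrightarrow> window_determined i n B \<Longrightarrow> window_determined i n (A \<union> B)"
  unfolding window_determined_def by blast

lemma window_determined_Int:
  "window_determined i n A \<Longrightarrow> window_determined i n B \<Longrightarrow> window_determined i n (A \<inter> B)"
  unfolding window_determined_def by blast

lemma window_determined_Diff:
  "window_determined i n A \<Longrightarrow> window_determined i n B \<Longrightarrow> window_determined i n (A - B)"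
  unfolding window_determined_def by (metis Diff_iff)

lemma window_determined_factor: "window_determined i n {y. P (biinf_factor y i n)}"
  unfolding window_determined_def by simp

text \<open>Symmetric windows are nested and cofinal, so nothing is lost by allowing only them.\<close>

definition finitary :: "(int \<Rightarrow> 'a) set \<Rightarrow> bool" where
  "finitary A \<longleftrightarrow> (\<exists>k. window_determined (- int k) (2 * k) A)"

lemma finitaryI:
  assumes "window_determined i n A"
  shows "finitary A"
  unfolding finitary_def
  by (rule exI[of _ "nat \<bar>i\<bar> + n"], rule window_determined_mono[OF assms]) auto

lemma finitary_common:
  assumes "finitary A" "finitary B"
  obtains k where "window_determined (- int k) (2 * k) A" "window_determined (- int k) (2 * k) B"
proof -
  obtain k l where kl: "window_determined (- int k) (2 * k) A" "window_determined (- int l) (2 * l) B"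
    using assms by (auto simp: finitary_def)
  show ?thesis
    by (rule that[of "max k l"]; rule window_determined_mono[OF kl(1)] window_determined_mono[OF kl(2)]) auto
qed

lemma finitary_Un: "finitary A \<Longrightarrow> finitary B \<Longrightarrow> finitary (A \<union> B)"
  by (metis finitaryI finitary_common window_determined_Un)

lemma finitary_Int: "finitary A \<Longrightarrow> finitary B \<Longrightarrow> finitary (A \<inter> B)"
  by (metis finitaryI finitary_common window_determined_Int)

lemma finitary_Diff: "finitary A \<Longrightarrow> finitary B \<Longrightarrow> finitary (A - B)"
  by (metis finitaryI finitary_common window_determined_Diff)

lemma finitary_empty: "finitary {}" and finitary_UNIV: "finitary UNIV"
  by (rule finitaryI[of 0 0]; simp add: window_determined_def)+

lemma finitary_factor: "finitary {y. P (biinf_factor y i n)}"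
  by (rule finitaryI[OF window_determined_factor])

abbreviation full_shift_topology :: "(int \<Rightarrow> 'a) topology" where
  "full_shift_topology \<equiv> product_topology (\<lambda>_. discrete_topology UNIV) UNIV"

lemma openin_letter: "openin full_shift_topology {y. y j = c}"
proof -
  have "openin full_shift_topology {y \<in> topspace full_shift_topology. y j \<in> {c}}"
    by (rule openin_continuous_map_preimage[OF continuous_map_product_projection]) auto
  then show ?thesis by (simp add: PiE_UNIV_domain)
qed

lemma openin_finitary:
  assumes "finitary A"
  shows "openin full_shift_topology A"
proof -
  obtain k where k: "window_determined (- int k) (2 * k) A" using assms by (auto simp: finitary_def)
  let ?J = "{- int k..<- int k + int (2 * k)}"
  let ?C = "\<lambda>y. topspace full_shift_topology \<inter> (\<Inter>j\<in>?J. {z. z j = y j})"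
  have "z \<in> A" if "y \<in> A" "\<forall>j\<in>?J. z j = y j" for y z
  proof -
    have "biinf_factor y (- int k) (2 * k) = biinf_factor z (- int k) (2 * k)"
      using that(2) unfolding factor_eq_iff by simp
    then show ?thesis using k that(1) unfolding window_determined_def by blast
  qed
  then have "A = (\<Union>y\<in>A. ?C y)"
    by (auto simp: PiE_UNIV_domain)
  moreover have "openin full_shift_topology (?C y)" for y
  proof (rule openin_Int_Inter)
    show "openin full_shift_topology (topspace full_shift_topology)" by (rule openin_topspace)
  qed (auto intro: openin_letter)
  then have "openin full_shift_topology (\<Union>y\<in>A. ?C y)"
    by (intro openin_Union) blast
  ultimately show ?thesis by (simp only:)
qed

lemma closedin_finitary:
  assumes "finitary A"
  shows "closedin full_shift_topology A"
  using openin_finitary[OF finitary_Diff[OF finitary_UNIV assms]]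
  by (simp add: closedin_def PiE_UNIV_domain)

text \<open>A basic open set of the product constrains finitely many coordinates, and these lie in
  some symmetric window.\<close>

lemma open_contains_window:
  assumes U: "openin full_shift_topology U" and y: "y \<in> U"
  obtains k where "{z. biinf_factor z (- int k) (2 * k) = biinf_factor y (- int k) (2 * k)} \<subseteq> U"
proof -
  obtain V where V: "finite {i. V i \<noteq> UNIV}" "y \<in> Pi\<^sub>E UNIV V" "Pi\<^sub>E UNIV V \<subseteq> U"
    using U y unfolding openin_product_topology_alt by auto
  define k where "k = Suc (nat (Max (insert 0 (abs ` {i. V i \<noteq> UNIV}))))"
  have k: "- int k \<le> i \<and> i < - int k + int (2 * k)" if "V i \<noteq> UNIV" for i
  proof -
    have "\<bar>i\<bar> \<le> Max (insert 0 (abs ` {i. V i \<noteq> UNIV}))"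
      using V(1) that by (intro Max_ge) auto
    moreover have "\<dots> < int k" unfolding k_def by simp
    ultimately show ?thesis by auto
  qed
  have "z \<in> U" if "biinf_factor z (- int k) (2 * k) = biinf_factor y (- int k) (2 * k)" for z
  proof -
    have "z i \<in> V i" for i
      using that k[of i] V(2) unfolding factor_eq_iff by (cases "V i = UNIV") (auto simp: PiE_UNIV_domain)
    then show ?thesis using V(3) by (auto simp: PiE_UNIV_domain)
  qed
  then show ?thesis by (intro that[of k]) auto
qed

definition window_weight :: "('a list \<Rightarrow> real) \<Rightarrow> int \<Rightarrow> nat \<Rightarrow> (int \<Rightarrow> 'a) set \<Rightarrow> real" where
  "window_weight \<nu> i n A = (\<Sum>w\<in>(\<lambda>y. biinf_factor y i n) ` A. \<nu> w)"

lemma finite_factors: "finite ((\<lambda>y. biinf_factor y i n) ` (A :: (int \<Rightarrow> 'a::finite) set))"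
  by (rule finite_subset[OF _ finite_lists_length_eq[of "UNIV :: 'a set" n]]) auto

lemma window_weight_grow_right:
  fixes \<nu> :: "'a::finite list \<Rightarrow> real"
  assumes right: "\<And>w. (\<Sum>c\<in>UNIV. \<nu> (w @ [c])) = \<nu> w" and A: "window_determined i n A"
  shows "window_weight \<nu> i (Suc n) A = window_weight \<nu> i n A"
proof -
  let ?W = "(\<lambda>y. biinf_factor y i n) ` A"
  have "(\<lambda>y. biinf_factor y i (Suc n)) ` A = (\<lambda>(w, c). w @ [c]) ` (?W \<times> UNIV)"
  proof safe
    fix y c assume y: "y \<in> A"
    define z where "z = y(i + int n := c)"
    have eq: "biinf_factor y i n = biinf_factor z i n" by (simp add: factor_eq_iff z_def)
    then have "z \<in> A" using A y unfolding window_determined_def by blast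
    moreover have "biinf_factor z i (Suc n) = biinf_factor y i n @ [c]"
      by (simp add: factor_snoc eq z_def)
    ultimately show "biinf_factor y i n @ [c] \<in> (\<lambda>y. biinf_factor y i (Suc n)) ` A"
      using \<open>z \<in> A\<close> by (metis (no_types, lifting) image_eqI)
  next
    fix y assume "y \<in> A"
    then show "biinf_factor y i (Suc n) \<in> (\<lambda>(w, c). w @ [c]) ` (?W \<times> UNIV)"
      unfolding factor_snoc by (intro image_eqI[of _ _ "(biinf_factor y i n, y (i + int n))"]) auto
  qed
  then have "window_weight \<nu> i (Suc n) A = (\<Sum>(w, c)\<in>?W \<times> UNIV. \<nu> (w @ [c]))"
    unfolding window_weight_def by (simp add: sum.reindex inj_on_def split_def)
  also have "\<dots> = (\<Sum>w\<in>?W. \<Sum>c\<in>UNIV. \<nu> (w @ [c]))"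
    by (rule sum.cartesian_product[symmetric])
  finally show ?thesis by (simp add: right window_weight_def)
qed

lemma window_weight_grow_left:
  fixes \<nu> :: "'a::finite list \<Rightarrow> real"
  assumes left: "\<And>w. (\<Sum>c\<in>UNIV. \<nu> (c # w)) = \<nu> w" and A: "window_determined i n A"
  shows "window_weight \<nu> (i - 1) (Suc n) A = window_weight \<nu> i n A"
proof -
  let ?W = "(\<lambda>y. biinf_factor y i n) ` A"
  have "(\<lambda>y. biinf_factor y (i - 1) (Suc n)) ` A = (\<lambda>(w, c). c # w) ` (?W \<times> UNIV)"
  proof safe
    fix y c assume y: "y \<in> A"
    define z where "z = y(i - 1 := c)"
    have eq: "biinf_factor y i n = biinf_factor z i n" by (simp add: factor_eq_iff z_def)
    then have "z \<in> A" using A y unfolding window_determined_def by blast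
    moreover have "biinf_factor z (i - 1) (Suc n) = c # biinf_factor y i n"
      by (simp add: factor_Cons eq z_def)
    ultimately show "c # biinf_factor y i n \<in> (\<lambda>y. biinf_factor y (i - 1) (Suc n)) ` A"
      using \<open>z \<in> A\<close> by (metis (no_types, lifting) image_eqI)
  next
    fix y assume "y \<in> A"
    then show "biinf_factor y (i - 1) (Suc n) \<in> (\<lambda>(w, c). c # w) ` (?W \<times> UNIV)"
      unfolding factor_Cons by (intro image_eqI[of _ _ "(biinf_factor y i n, y (i - 1))"]) auto
  qed
  then have "window_weight \<nu> (i - 1) (Suc n) A = (\<Sum>(w, c)\<in>?W \<times> UNIV. \<nu> (c # w))"
    unfolding window_weight_def by (simp add: sum.reindex inj_on_def split_def)
  also have "\<dots> = (\<Sum>w\<in>?W. \<Sum>c\<in>UNIV. \<nu> (c # w))"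
    by (rule sum.cartesian_product[symmetric])
  finally show ?thesis by (simp add: left window_weight_def)
qed

text \<open>Right and left consistency of \<open>\<nu>\<close> say that enlarging the window by one position on
  either side does not change the weight; a common larger window then compares any two.\<close>

lemma window_weight_indep:
  fixes \<nu> :: "'a::finite list \<Rightarrow> real"
  assumes right: "\<And>w. (\<Sum>c\<in>UNIV. \<nu> (w @ [c])) = \<nu> w"
    and left: "\<And>w. (\<Sum>c\<in>UNIV. \<nu> (c # w)) = \<nu> w"
    and A: "window_determined i n A" and A': "window_determined i' n' A"
  shows "window_weight \<nu> i n A = window_weight \<nu> i' n' A"
proof -
  have grow: "window_weight \<nu> (i - int p) (n + p + q) A = window_weight \<nu> i n A"
    if A: "window_determined i n A" for i n p q
  proof -
    have det: "window_determined (i - int p) (n + p + q) A" for p q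
      by (rule window_determined_mono[OF A]) auto
    have "window_weight \<nu> (i - int p) (n + p) A = window_weight \<nu> i n A"
    proof (induction p)
      case (Suc p)
      then show ?case
        using window_weight_grow_left[OF left det[of p 0]] by (simp add: algebra_simps)
    qed simp
    then show ?thesis
    proof (induction q)
      case (Suc q)
      then show ?case using window_weight_grow_right[OF right det[of p q]] by simp
    qed simp
  qed
  define m where "m = nat \<bar>i\<bar> + nat \<bar>i'\<bar> + n + n'"
  have common: "window_weight \<nu> i n A = window_weight \<nu> (- int m) (2 * m) A"
    if A: "window_determined i n A" and m: "\<bar>i\<bar> + int n \<le> int m" for i n
  proof -
    have "i - int (nat (i + int m)) = - int m" "n + nat (i + int m) + nat (int m - i - int n) = 2 * m"
      using m by auto
    then show ?thesis
      using grow[OF A, of "nat (i + int m)" "nat (int m - i - int n)"] by simp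
  qed
  show ?thesis
    using common[OF A] common[OF A'] by (simp add: m_def)
qed

text \<open>By \<open>window_weight_indep\<close> the choice of \<open>k\<close> is immaterial for finitary \<open>A\<close>.\<close>

definition finitary_content :: "('a list \<Rightarrow> real) \<Rightarrow> (int \<Rightarrow> 'a) set \<Rightarrow> real" where
  "finitary_content \<nu> A = (let k = (SOME k. window_determined (- int k) (2 * k) A)
     in window_weight \<nu> (- int k) (2 * k) A)"

text \<open>The two-sided Kolmogorov extension for a finite alphabet, by Caratheodory. The content of
  finitary sets is additive since two disjoint sets have disjoint sets of words in a common
  window. It is continuous at \<open>{}\<close> for a topological reason: finitary sets are closed in a
  compact space, so a decreasing sequence of them with empty intersection reaches \<open>{}\<close>.\<close>

theorem consistent_weights_extend:
  fixes \<nu> :: "'a::finite list \<Rightarrow> real"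
  assumes nonneg: "\<And>w. 0 \<le> \<nu> w"
    and right: "\<And>w. (\<Sum>c\<in>UNIV. \<nu> (w @ [c])) = \<nu> w"
    and left: "\<And>w. (\<Sum>c\<in>UNIV. \<nu> (c # w)) = \<nu> w"
  shows "\<exists>M. space M = UNIV \<and> sets M = sigma_sets UNIV {A. finitary A} \<and>
    (\<forall>i w. emeasure M {y. biinf_factor y i (length w) = w} = ennreal (\<nu> w))"
proof -
  define \<A> where "\<A> = {A :: (int \<Rightarrow> 'a) set. finitary A}"
  have content: "finitary_content \<nu> A = window_weight \<nu> i n A" if "window_determined i n A" for i n A
  proof -
    have "\<exists>k. window_determined (- int k) (2 * k) A"
      using finitaryI[OF that] by (simp add: finitary_def)
    then have "window_determined (- int (SOME k. window_determined (- int k) (2 * k) A))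
        (2 * (SOME k. window_determined (- int k) (2 * k) A)) A"
      by (rule someI_ex)
    then show ?thesis
      unfolding finitary_content_def Let_def by (rule window_weight_indep[OF right left _ that])
  qed
  have content_nonneg: "0 \<le> finitary_content \<nu> A" for A
    unfolding finitary_content_def Let_def window_weight_def by (intro sum_nonneg nonneg)
  interpret ring_of_sets UNIV \<A>
    by (rule ring_of_setsI) (simp_all add: \<A>_def finitary_empty finitary_Un finitary_Diff)
  have positive: "positive \<A> (\<lambda>A. ennreal (finitary_content \<nu> A))"
    using content[of 0 0 "{}"] by (simp add: positive_def window_determined_def window_weight_def)
  have additive: "additive \<A> (\<lambda>A. ennreal (finitary_content \<nu> A))"
    unfolding additive_def
  proof (intro ballI impI)
    fix A B assume AB: "A \<in> \<A>" "B \<in> \<A>" "A \<inter> B = {}"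
    obtain k where k: "window_determined (- int k) (2 * k) A" "window_determined (- int k) (2 * k) B"
      using finitary_common[of A B] AB by (auto simp: \<A>_def)
    let ?f = "\<lambda>y :: int \<Rightarrow> 'a. biinf_factor y (- int k) (2 * k)"
    have "?f ` A \<inter> ?f ` B = {}"
      using k AB(3) unfolding window_determined_def by blast
    then have "window_weight \<nu> (- int k) (2 * k) (A \<union> B)
        = window_weight \<nu> (- int k) (2 * k) A + window_weight \<nu> (- int k) (2 * k) B"
      unfolding window_weight_def image_Un by (intro sum.union_disjoint finite_factors)
    then have "finitary_content \<nu> (A \<union> B) = finitary_content \<nu> A + finitary_content \<nu> B"
      using content[OF k(1)] content[OF k(2)] content[OF window_determined_Un[OF k]] by simp
    then show "ennreal (finitary_content \<nu> (A \<union> B)) = ennreal (finitary_content \<nu> A) + ennreal (finitary_content \<nu> B)"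
      using content_nonneg by simp
  qed
  have cont: "(\<lambda>i. ennreal (finitary_content \<nu> (A i))) \<longlonglongrightarrow> 0"
    if A: "range A \<subseteq> \<A>" "decseq A" "(\<Inter>i. A i) = {}" for A
  proof -
    have "\<exists>N. A N = {}"
    proof (rule ccontr)
      assume ne: "\<nexists>N. A N = {}"
      have "compact_space (full_shift_topology :: (int \<Rightarrow> 'a) topology)"
        by (simp add: compact_space_product_topology compact_space_discrete_topology)
      moreover have "\<forall>C\<in>range A. closedin full_shift_topology C"
        using A(1) by (auto simp: \<A>_def intro: closedin_finitary)
      moreover have "\<Inter>\<F> \<noteq> {}" if F: "finite \<F>" "\<F> \<subseteq> range A" for \<F>
      proof -
        obtain I where I: "finite I" "\<F> = A ` I" using finite_subset_image[OF F] by blast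
        have "A (Max (insert 0 I)) \<subseteq> A i" if "i \<in> I" for i
          using A(2) I that by (auto simp: decseq_def)
        then have "A (Max (insert 0 I)) \<subseteq> \<Inter>\<F>" using I by auto
        then show ?thesis using ne by blast
      qed
      ultimately have "\<Inter>(range A) \<noteq> {}"
        unfolding compact_space_fip by blast
      then show False using A(3) by simp
    qed
    then obtain N where "A N = {}" by blast
    then have "A i = {}" if "N \<le> i" for i
      using A(2) that by (auto simp: decseq_def)
    then have "\<forall>\<^sub>F i in sequentially. ennreal (finitary_content \<nu> (A i)) = 0"
      using positive by (auto simp: positive_def intro!: eventually_sequentiallyI[of N])
    then show ?thesis by (rule tendsto_eventually)
  qed
  have "\<exists>\<mu>. (\<forall>A\<in>\<A>. \<mu> A = ennreal (finitary_content \<nu> A))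
      \<and> measure_space UNIV (sigma_sets UNIV \<A>) \<mu>"
    by (rule caratheodory_empty_continuous[OF positive additive]) (simp, rule cont)
  then obtain \<mu> where \<mu>: "\<And>A. A \<in> \<A> \<Longrightarrow> \<mu> A = ennreal (finitary_content \<nu> A)"
    and meas: "measure_space UNIV (sigma_sets UNIV \<A>) \<mu>"
    by blast
  define M where "M = measure_of UNIV \<A> \<mu>"
  have em: "emeasure M A = ennreal (finitary_content \<nu> A)" if "A \<in> \<A>" for A
  proof -
    have "emeasure M A = \<mu> A"
      unfolding M_def
      using meas that
      by (intro emeasure_measure_of[OF refl]) (auto simp: measure_space_def sets_measure_of)
    then show ?thesis using \<mu>[OF that] by simp
  qed
  show ?thesis
  proof (intro exI[of _ M] conjI allI)
    show "space M = UNIV" by (simp add: M_def space_measure_of)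
    show "sets M = sigma_sets UNIV {A. finitary A}" by (simp add: M_def sets_measure_of \<A>_def)
    fix i :: int and w :: "'a list"
    let ?A = "{y. biinf_factor y i (length w) = w}"
    have det: "window_determined i (length w) ?A" by (rule window_determined_factor)
    have "(\<lambda>y. biinf_factor y i (length w)) ` ?A = {w}"
      using ex_factor_eq[of i w] by auto
    then have "finitary_content \<nu> ?A = \<nu> w"
      by (simp add: content[OF det] window_weight_def)
    then show "emeasure M ?A = ennreal (\<nu> w)"
      using em[of ?A] finitaryI[OF det] by (simp add: \<A>_def)
  qed
qed

section \<open>Invariant measures on the substitution subshift\<close>

abbreviation window_cylinder :: "('a \<Rightarrow> 'a list) \<Rightarrow> int \<Rightarrow> 'a list \<Rightarrow> (int \<Rightarrow> 'a) set" where
  "window_cylinder \<zeta> i w \<equiv> {y \<in> subst_subshift \<zeta>. biinf_factor y i (length w) = w}"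

lemma topspace_subshift [simp]: "topspace (subshift_topology \<zeta>) = subst_subshift \<zeta>"
  by (simp add: subshift_topology_def PiE_UNIV_domain)

lemma factor_shift: "biinf_factor (biinf_shift y) i n = biinf_factor y (i + 1) n"
  by (simp add: biinf_factor_def biinf_shift_def algebra_simps)

lemma shift_in_subshift: "y \<in> subst_subshift \<zeta> \<Longrightarrow> biinf_shift y \<in> subst_subshift \<zeta>"
  by (simp add: subst_subshift_def factor_shift)

lemma finitary_vimage_shift:
  assumes "finitary A"
  shows "finitary (biinf_shift -` A)"
proof -
  obtain k where "window_determined (- int k) (2 * k) A" using assms by (auto simp: finitary_def)
  then have "window_determined (- int k + 1) (2 * k) (biinf_shift -` A)"
    unfolding window_determined_def vimage_eq factor_shift[symmetric] by blast
  then show ?thesis by (rule finitaryI)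
qed

text \<open>Open sets are countable unions of window cylinders, because there are only countably
  many symmetric windows and finitely many words in each.\<close>

lemma openin_eq_countable_Union_finitary:
  fixes U :: "(int \<Rightarrow> 'a::finite) set"
  assumes "openin full_shift_topology U"
  obtains \<F> where "countable \<F>" "\<And>A. A \<in> \<F> \<Longrightarrow> finitary A" "U = \<Union>\<F>"
proof
  let ?cyl = "\<lambda>(k, w). {z :: int \<Rightarrow> 'a. biinf_factor z (- int k) (2 * k) = w}"
  let ?F = "{A \<in> range ?cyl. A \<subseteq> U}"
  show "countable ?F"
    by (rule countable_subset[of _ "range ?cyl"]) auto
  show "finitary A" if "A \<in> ?F" for A
    using that by (auto intro: finitary_factor)
  show "U = \<Union>?F"
  proof
    show "U \<subseteq> \<Union>?F"
    proof
      fix y assume "y \<in> U"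
      then obtain k where k: "{z. biinf_factor z (- int k) (2 * k) = biinf_factor y (- int k) (2 * k)} \<subseteq> U"
        using open_contains_window[OF assms] by blast
      have "?cyl (k, biinf_factor y (- int k) (2 * k)) \<in> ?F" using k by auto
      moreover have "y \<in> ?cyl (k, biinf_factor y (- int k) (2 * k))" by simp
      ultimately show "y \<in> \<Union>?F" by (rule UnionI)
    qed
  qed auto
qed

lemma borel_sets_eq_finitary:
  fixes \<zeta> :: "'a::finite \<Rightarrow> 'a list"
  shows "sigma_sets (subst_subshift \<zeta>) {U. openin (subshift_topology \<zeta>) U}
    = sigma_sets (subst_subshift \<zeta>) ((\<inter>) (subst_subshift \<zeta>) ` {A. finitary A})"
    (is "sigma_sets ?S ?O = sigma_sets ?S ?E")
proof
  show "sigma_sets ?S ?O \<subseteq> sigma_sets ?S ?E"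
  proof (rule sigma_sets_mono, rule subsetI)
    fix U assume "U \<in> ?O"
    then obtain V where V: "openin full_shift_topology V" "U = ?S \<inter> V"
      by (auto simp: subshift_topology_def openin_subtopology Int_commute)
    obtain \<F> where \<F>: "countable \<F>" "\<And>A. A \<in> \<F> \<Longrightarrow> finitary A" "V = \<Union>\<F>"
      using openin_eq_countable_Union_finitary[OF V(1)] by blast
    have "U = \<Union>((\<inter>) ?S ` \<F>)" using V \<F> by auto
    also have "\<dots> \<in> sigma_sets ?S ?E"
      by (rule sigma_sets_UNION) (use \<F> in auto)
    finally show "U \<in> sigma_sets ?S ?E" .
  qed
  show "sigma_sets ?S ?E \<subseteq> sigma_sets ?S ?O"
  proof (rule sigma_sets_mono, rule subsetI)
    fix B assume "B \<in> ?E"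
    then have "B \<in> ?O"
      by (auto simp: subshift_topology_def openin_subtopology dest: openin_finitary)
    then show "B \<in> sigma_sets ?S ?O" by (rule sigma_sets.Basic)
  qed
qed

lemma borel_measure_on_subshift_iff:
  fixes \<zeta> :: "'a::finite \<Rightarrow> 'a list"
  shows "borel_measure_on (subshift_topology \<zeta>) \<mu> \<longleftrightarrow> space \<mu> = subst_subshift \<zeta> \<and>
    sets \<mu> = sigma_sets (subst_subshift \<zeta>) ((\<inter>) (subst_subshift \<zeta>) ` {A. finitary A})"
  by (simp add: borel_measure_on_def borel_sets_eq_finitary)

lemma finitary_in_sets:
  fixes \<zeta> :: "'a::finite \<Rightarrow> 'a list"
  assumes "borel_measure_on (subshift_topology \<zeta>) \<mu>" "finitary A"
  shows "subst_subshift \<zeta> \<inter> A \<in> sets \<mu>"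
  using assms by (auto simp: borel_measure_on_subshift_iff intro!: sigma_sets.Basic)

lemma window_cylinder_in_sets:
  fixes \<zeta> :: "'a::finite \<Rightarrow> 'a list"
  assumes "borel_measure_on (subshift_topology \<zeta>) \<mu>"
  shows "window_cylinder \<zeta> i w \<in> sets \<mu>"
  using finitary_in_sets[OF assms finitary_factor[of "\<lambda>v. v = w" i "length w"]]
  by (simp add: Int_def)

lemma emeasure_eq_sum_window_cylinders:
  fixes \<zeta> :: "'a::finite \<Rightarrow> 'a list"
  assumes \<mu>: "borel_measure_on (subshift_topology \<zeta>) \<mu>" and A: "window_determined i n A"
  shows "emeasure \<mu> (subst_subshift \<zeta> \<inter> A)
    = (\<Sum>w\<in>(\<lambda>y. biinf_factor y i n) ` A. emeasure \<mu> (window_cylinder \<zeta> i w))"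
proof -
  let ?W = "(\<lambda>y. biinf_factor y i n) ` A"
  have "(\<Sum>w\<in>?W. emeasure \<mu> (window_cylinder \<zeta> i w)) = emeasure \<mu> (\<Union>w\<in>?W. window_cylinder \<zeta> i w)"
    by (rule sum_emeasure)
      (auto simp: disjoint_family_on_def finite_factors intro: window_cylinder_in_sets[OF \<mu>])
  also have "(\<Union>w\<in>?W. window_cylinder \<zeta> i w) = subst_subshift \<zeta> \<inter> A"
  proof (intro equalityI subsetI)
    fix y assume "y \<in> (\<Union>w\<in>?W. window_cylinder \<zeta> i w)"
    then obtain z where "z \<in> A" "y \<in> subst_subshift \<zeta>" "biinf_factor z i n = biinf_factor y i n"
      by auto
    then show "y \<in> subst_subshift \<zeta> \<inter> A"
      using A unfolding window_determined_def by blast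
  next
    fix y assume "y \<in> subst_subshift \<zeta> \<inter> A"
    then show "y \<in> (\<Union>w\<in>?W. window_cylinder \<zeta> i w)" by auto
  qed
  finally show ?thesis by simp
qed

text \<open>The traces of finitary sets form an intersection-stable generator, and each of them is a
  finite disjoint union of window cylinders. Windows may be taken of odd, hence positive, length,
  so that the empty word is avoided.\<close>

lemma measure_eqI_window_cylinders:
  fixes \<zeta> :: "'a::finite \<Rightarrow> 'a list"
  assumes \<mu>: "borel_measure_on (subshift_topology \<zeta>) \<mu>"
    and \<mu>': "borel_measure_on (subshift_topology \<zeta>) \<mu>'"
    and eq: "\<And>i w. w \<noteq> [] \<Longrightarrow>
      emeasure \<mu> (window_cylinder \<zeta> i w) = emeasure \<mu>' (window_cylinder \<zeta> i w)"
    and fin: "\<And>w. w \<noteq> [] \<Longrightarrow> emeasure \<mu> (window_cylinder \<zeta> 1 w) \<noteq> \<infinity>"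
  shows "\<mu> = \<mu>'"
proof (rule measure_eqI_generator_eq[where \<Omega> = "subst_subshift \<zeta>"
      and E = "(\<inter>) (subst_subshift \<zeta>) ` {A. finitary A}" and A = "\<lambda>_. subst_subshift \<zeta>"])
  let ?S = "subst_subshift \<zeta>"
  show "Int_stable ((\<inter>) ?S ` {A. finitary A})"
  proof (rule Int_stableI)
    fix B B' assume "B \<in> (\<inter>) ?S ` {A. finitary A}" "B' \<in> (\<inter>) ?S ` {A. finitary A}"
    then obtain A A' where "finitary A" "finitary A'" "B = ?S \<inter> A" "B' = ?S \<inter> A'" by auto
    then show "B \<inter> B' \<in> (\<inter>) ?S ` {A. finitary A}"
      using finitary_Int[of A A'] by (intro image_eqI[of _ _ "A \<inter> A'"]) auto
  qed
  show "emeasure \<mu> X = emeasure \<mu>' X" if X: "X \<in> (\<inter>) ?S ` {A. finitary A}" for X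
  proof -
    obtain A k where A: "window_determined (- int k) (2 * k) A" "X = ?S \<inter> A"
      using X by (auto simp: finitary_def)
    \<comment> \<open>for \<open>k = 0\<close> the symmetric window is empty\<close>
    have A': "window_determined (- int k) (Suc (2 * k)) A"
      by (rule window_determined_mono[OF A(1)]) auto
    have "w \<noteq> []" if "w \<in> (\<lambda>y. biinf_factor y (- int k) (Suc (2 * k))) ` A" for w
      using that by (auto simp: factor_snoc)
    then show ?thesis
      unfolding A(2) emeasure_eq_sum_window_cylinders[OF \<mu> A'] emeasure_eq_sum_window_cylinders[OF \<mu>' A']
      by (intro sum.cong refl eq)
  qed
  show "range (\<lambda>_. ?S) \<subseteq> (\<inter>) ?S ` {A. finitary A}"
    using finitary_UNIV by (auto intro!: image_eqI[of _ _ UNIV])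
  have "emeasure \<mu> ?S = (\<Sum>w\<in>range (\<lambda>y. biinf_factor y 1 1). emeasure \<mu> (window_cylinder \<zeta> 1 w))"
    using emeasure_eq_sum_window_cylinders[OF \<mu>, of 1 1 UNIV] by (simp add: window_determined_def)
  also have "\<dots> \<noteq> \<infinity>"
  proof -
    have "w \<noteq> []" if "w \<in> range (\<lambda>y. biinf_factor y 1 1)" for w :: "'a list"
      using that by (auto simp: biinf_factor_def)
    then have "\<forall>w\<in>range (\<lambda>y. biinf_factor y 1 1). emeasure \<mu> (window_cylinder \<zeta> 1 w) \<noteq> top"
      using fin unfolding infinity_ennreal_def by blast
    then show ?thesis
      unfolding infinity_ennreal_def ennreal_sum_eq_top[OF finite_factors] by blast
  qed
  finally show "emeasure \<mu> ?S \<noteq> \<infinity>" .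
qed (use \<mu> \<mu>' in \<open>auto simp: borel_measure_on_subshift_iff\<close>)

text \<open>Invariance moves a window one step at a time, so that the cylinders at position \<open>1\<close>
  control all others.\<close>

lemma invariant_window_cylinder:
  fixes \<zeta> :: "'a::finite \<Rightarrow> 'a list"
  assumes \<mu>: "borel_measure_on (subshift_topology \<zeta>) \<mu>" and inv: "invariant_measure biinf_shift \<mu>"
  shows "emeasure \<mu> (window_cylinder \<zeta> i w) = emeasure \<mu> (window_cylinder \<zeta> 1 w)"
proof -
  have step: "emeasure \<mu> (window_cylinder \<zeta> (i + 1) w) = emeasure \<mu> (window_cylinder \<zeta> i w)" for i
  proof -
    have "biinf_shift -` window_cylinder \<zeta> i w \<inter> space \<mu> = window_cylinder \<zeta> (i + 1) w"
      using \<mu> shift_in_subshift by (auto simp: borel_measure_on_subshift_iff factor_shift)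
    then show ?thesis
      using inv window_cylinder_in_sets[OF \<mu>, of i w] by (auto simp: invariant_measure_def)
  qed
  show ?thesis
  proof (induction i rule: int_induct[of _ 1])
    case (step1 i)
    then show ?case using step[of i] by simp
  next
    case (step2 i)
    then show ?case using step[of "i - 1"] by simp
  qed simp
qed

text \<open>The measure on the full shift gives mass \<open>0\<close> to each of the countably many cylinders that
  prescribe a word outside the language, and these cover the complement of the subshift. Hence
  restricting it to the subshift loses no mass. The restriction is invariant because its values
  on window cylinders do not depend on the position of the window.\<close>

theorem invariant_measure_of_weights:
  fixes \<zeta> :: "'a::finite \<Rightarrow> 'a list" and \<nu> :: "'a list \<Rightarrow> real"
  assumes nonneg: "\<And>w. 0 \<le> \<nu> w"
    and right: "\<And>w. (\<Sum>c\<in>UNIV. \<nu> (w @ [c])) = \<nu> w"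
    and left: "\<And>w. (\<Sum>c\<in>UNIV. \<nu> (c # w)) = \<nu> w"
    and supp: "\<And>w. w \<notin> subst_language \<zeta> \<Longrightarrow> \<nu> w = 0"
  shows "\<exists>\<mu>. borel_measure_on (subshift_topology \<zeta>) \<mu> \<and> invariant_measure biinf_shift \<mu> \<and>
    (\<forall>w. emeasure \<mu> (subst_cylinder \<zeta> w) = ennreal (\<nu> w))"
proof -
  let ?S = "subst_subshift \<zeta>"
  obtain M where M: "space M = UNIV" "sets M = sigma_sets UNIV {A. finitary A}"
    and em: "\<And>i w. emeasure M {y. biinf_factor y i (length w) = w} = ennreal (\<nu> w)"
    using consistent_weights_extend[OF nonneg right left] by blast
  have fin_M: "A \<in> sets M" if "finitary A" for A
    using that by (simp add: M(2) sigma_sets.Basic)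
  have "AE y in M. \<forall>i n w. w \<notin> subst_language \<zeta> \<longrightarrow> length w = n \<longrightarrow> biinf_factor y i n \<noteq> w"
    unfolding AE_all_countable
  proof (intro allI)
    fix i :: int and n and w :: "'a list"
    show "AE y in M. w \<notin> subst_language \<zeta> \<longrightarrow> length w = n \<longrightarrow> biinf_factor y i n \<noteq> w"
    proof (cases "w \<notin> subst_language \<zeta> \<and> length w = n")
      case True
      then have "{y. biinf_factor y i n = w} \<in> null_sets M"
        using em[of i w] supp[of w] fin_M[OF finitary_factor[of "\<lambda>v. v = w" i n]]
        by (auto simp: null_sets_def)
      from AE_not_in[OF this] show ?thesis by simp
    qed auto
  qed
  then have AE_S: "AE y in M. y \<in> ?S"
  proof (rule AE_mp, intro AE_I2 impI)
    fix y assume y: "\<forall>i n w. w \<notin> subst_language \<zeta> \<longrightarrow> length w = n \<longrightarrow> biinf_factor y i n \<noteq> w"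
    have "biinf_factor y i n \<in> subst_language \<zeta>" for i n
      using y[rule_format, of "biinf_factor y i n" n i] by auto
    then show "y \<in> ?S" by (simp add: subst_subshift_def)
  qed
  have S_sets: "?S \<in> sets M"
  proof -
    have "?S = (\<Inter>i. \<Inter>n. {y. biinf_factor y i n \<in> subst_language \<zeta>})"
      by (auto simp: subst_subshift_def)
    also have "\<dots> \<in> sets M"
      by (intro sets.countable_INT'' fin_M finitary_factor finitary_UNIV) (auto simp: M)
    finally show ?thesis .
  qed
  define \<mu> where "\<mu> = restrict_space M ?S"
  have sets_\<mu>: "sets \<mu> = sigma_sets ?S ((\<inter>) ?S ` {A. finitary A})"
    unfolding \<mu>_def sets_restrict_space M(2)
    by (rule sigma_sets_Int) (use S_sets M(2) in simp_all)
  have borel: "borel_measure_on (subshift_topology \<zeta>) \<mu>"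
    by (simp add: borel_measure_on_subshift_iff sets_\<mu>) (simp add: \<mu>_def space_restrict_space M)
  have em_\<mu>: "emeasure \<mu> (window_cylinder \<zeta> i w) = ennreal (\<nu> w)" for i w
  proof -
    have "emeasure \<mu> (window_cylinder \<zeta> i w) = emeasure M (window_cylinder \<zeta> i w)"
      unfolding \<mu>_def by (rule emeasure_restrict_space) (use S_sets M in auto)
    also have "\<dots> = emeasure M {y. biinf_factor y i (length w) = w}"
    proof (rule emeasure_eq_AE)
      show "window_cylinder \<zeta> i w \<in> sets M"
        using sets.Int[OF S_sets fin_M[OF finitary_factor[of "\<lambda>v. v = w" i "length w"]]]
        by (simp add: Int_def)
    qed (use AE_S fin_M finitary_factor[of "\<lambda>v. v = w" i "length w"] in auto)
    finally show ?thesis by (simp add: em)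
  qed
  have shift: "biinf_shift \<in> measurable \<mu> \<mu>"
  proof (rule measurable_sigma_sets[OF sets_\<mu>])
    show "biinf_shift \<in> space \<mu> \<rightarrow> ?S"
      using borel shift_in_subshift by (auto simp: borel_measure_on_subshift_iff)
    fix B assume "B \<in> (\<inter>) ?S ` {A. finitary A}"
    then obtain A where A: "finitary A" "B = ?S \<inter> A" by auto
    have "biinf_shift -` B \<inter> space \<mu> = ?S \<inter> biinf_shift -` A"
      using borel shift_in_subshift by (auto simp: borel_measure_on_subshift_iff A(2))
    then show "biinf_shift -` B \<inter> space \<mu> \<in> sets \<mu>"
      using finitary_in_sets[OF borel finitary_vimage_shift[OF A(1)]] by simp
  qed auto
  have "distr \<mu> \<mu> biinf_shift = \<mu>"
  proof (rule measure_eqI_window_cylinders)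
    show "borel_measure_on (subshift_topology \<zeta>) (distr \<mu> \<mu> biinf_shift)" "borel_measure_on (subshift_topology \<zeta>) \<mu>"
      using borel by (simp_all add: borel_measure_on_def)
    have distr: "emeasure (distr \<mu> \<mu> biinf_shift) (window_cylinder \<zeta> i w) = ennreal (\<nu> w)" for i w
    proof -
      have "biinf_shift -` window_cylinder \<zeta> i w \<inter> space \<mu> = window_cylinder \<zeta> (i + 1) w"
        using borel shift_in_subshift by (auto simp: borel_measure_on_subshift_iff factor_shift)
      then show ?thesis
        by (simp add: emeasure_distr[OF shift window_cylinder_in_sets[OF borel]] em_\<mu>)
    qed
    then show "emeasure (distr \<mu> \<mu> biinf_shift) (window_cylinder \<zeta> i w) = emeasure \<mu> (window_cylinder \<zeta> i w)" for i w
      by (simp add: em_\<mu>)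
    show "emeasure (distr \<mu> \<mu> biinf_shift) (window_cylinder \<zeta> 1 w) \<noteq> \<infinity>" for w
      by (simp add: distr)
  qed
  then have "invariant_measure biinf_shift \<mu>"
    unfolding invariant_measure_def using shift emeasure_distr[OF shift] by metis
  moreover have "emeasure \<mu> (subst_cylinder \<zeta> w) = ennreal (\<nu> w)" for w
    using em_\<mu>[of 1 w] by (simp add: subst_cylinder_def)
  ultimately show ?thesis using borel by blast
qed

text \<open>Frequencies of \<open>w\<close> and of its one-letter extensions differ by at most one occurrence
  divided by the length, which tends to infinity.\<close>

section \<open>The frequency measure of a letter\<close>

lemma limit_frequencies_consistent:
  fixes \<zeta> :: "'a::finite \<Rightarrow> 'a list"
  assumes exp: "expanding \<zeta>" and s: "1 \<le> s" and conv: "freqs_converge \<zeta> s a"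
  defines "\<nu> \<equiv> \<lambda>w. lim (subst_freq \<zeta> s a w)"
  shows "0 \<le> \<nu> w" and "(\<Sum>c\<in>UNIV. \<nu> (w @ [c])) = \<nu> w" and "(\<Sum>c\<in>UNIV. \<nu> (c # w)) = \<nu> w"
    and "w \<notin> subst_language \<zeta> \<Longrightarrow> \<nu> w = 0"
proof -
  define u where "u t = subst_iter \<zeta> (s * t) a" for t
  have F: "subst_freq \<zeta> s a w t = real (occurrences w (u t)) / real (length (u t))" for w t
    by (simp add: subst_freq_def u_def)
  have len0: "0 < length (u t)" for t
    using expanding_length_mono[OF exp, of 0 "s * t" a] by (simp add: u_def Suc_le_eq)
  have len: "(\<lambda>t. 1 / real (length (u t))) \<longlonglongrightarrow> 0"
  proof -
    have "filterlim (\<lambda>t. length (u t)) at_top sequentially"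
      unfolding filterlim_at_top
    proof
      fix m
      obtain r where r: "\<And>r' b. r \<le> r' \<Longrightarrow> m \<le> length (subst_iter \<zeta> r' b)"
        using expanding_length_unbounded[OF exp, of m] by blast
      have "m \<le> length (u t)" if "r \<le> t" for t
        unfolding u_def by (rule r) (use that s mult_le_mono1[of 1 s t] in linarith)
      then show "\<forall>\<^sub>F t in sequentially. m \<le> length (u t)"
        by (rule eventually_sequentiallyI)
    qed
    then show ?thesis
      by (intro tendsto_divide_0[OF tendsto_const] filterlim_at_top_imp_at_infinity
          filterlim_compose[OF filterlim_real_sequentially])
  qed
  have F_lim: "subst_freq \<zeta> s a w \<longlonglongrightarrow> \<nu> w" for w
  proof (cases "w = []")
    case True
    \<comment> \<open>the empty word occurs once more than there are letters\<close>
    have "subst_freq \<zeta> s a [] t = 1 + 1 / real (length (u t))" for t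
    proof -
      have "occurrences [] (u t) = length (u t) + 1"
        by (simp add: occurrences_def atMost_def[symmetric])
      then show ?thesis using len0[of t] by (simp add: F add_divide_distrib)
    qed
    then have "subst_freq \<zeta> s a [] = (\<lambda>t. 1 + 1 / real (length (u t)))" by (rule ext)
    then have "subst_freq \<zeta> s a [] \<longlonglongrightarrow> 1 + 0"
      using tendsto_add[OF tendsto_const[of 1] len] by (simp only:)
    then have "convergent (subst_freq \<zeta> s a [])" by (rule convergentI)
    then show ?thesis using True by (simp add: \<nu>_def convergent_LIMSEQ_iff)
  next
    case False
    then show ?thesis using conv by (simp add: \<nu>_def freqs_converge_def convergent_LIMSEQ_iff)
  qed
  show "0 \<le> \<nu> w"
    by (rule LIMSEQ_le_const[OF F_lim]) (auto simp: F)
  have sum_eq: "(\<Sum>c\<in>UNIV. \<nu> (f c)) = \<nu> w"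
    if f: "\<And>u. (\<Sum>c\<in>UNIV. occurrences (f c) u) \<le> occurrences w u"
      "\<And>u. occurrences w u \<le> (\<Sum>c\<in>UNIV. occurrences (f c) u) + 1" for f :: "'a \<Rightarrow> 'a list"
  proof -
    have "(\<lambda>t. subst_freq \<zeta> s a w t - (\<Sum>c\<in>UNIV. subst_freq \<zeta> s a (f c) t))
        \<longlonglongrightarrow> \<nu> w - (\<Sum>c\<in>UNIV. \<nu> (f c))"
      by (intro tendsto_intros F_lim)
    moreover have "(\<lambda>t. subst_freq \<zeta> s a w t - (\<Sum>c\<in>UNIV. subst_freq \<zeta> s a (f c) t)) \<longlonglongrightarrow> 0"
    proof (rule Lim_null_comparison[OF always_eventually len], rule allI)
      fix t
      have "subst_freq \<zeta> s a w t - (\<Sum>c\<in>UNIV. subst_freq \<zeta> s a (f c) t)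
          = (real (occurrences w (u t)) - real (\<Sum>c\<in>UNIV. occurrences (f c) (u t))) / real (length (u t))"
        by (simp add: F diff_divide_distrib sum_divide_distrib)
      moreover have "0 \<le> real (occurrences w (u t)) - real (\<Sum>c\<in>UNIV. occurrences (f c) (u t))"
        "real (occurrences w (u t)) - real (\<Sum>c\<in>UNIV. occurrences (f c) (u t)) \<le> 1"
        using f[of "u t"] by linarith+
      ultimately show "norm (subst_freq \<zeta> s a w t - (\<Sum>c\<in>UNIV. subst_freq \<zeta> s a (f c) t))
          \<le> 1 / real (length (u t))"
        by (simp add: divide_right_mono del: of_nat_sum)
    qed
    ultimately have "\<nu> w - (\<Sum>c\<in>UNIV. \<nu> (f c)) = 0" by (rule LIMSEQ_unique)
    then show ?thesis by simp
  qed
  show "(\<Sum>c\<in>UNIV. \<nu> (w @ [c])) = \<nu> w" by (rule sum_eq; rule occurrences_snoc)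
  show "(\<Sum>c\<in>UNIV. \<nu> (c # w)) = \<nu> w" by (rule sum_eq; rule occurrences_Cons)
  show "\<nu> w = 0" if w: "w \<notin> subst_language \<zeta>"
  proof -
    have "occurrences w (u t) = 0" for t
    proof -
      have "take (length w) (drop i (u t)) \<noteq> w" for i
      proof
        assume "take (length w) (drop i (u t)) = w"
        then have "sublist w (u t)"
          by (metis sublist_take sublist_drop sublist_order.order_trans)
        then show False using w by (auto simp: subst_language_def u_def)
      qed
      then show ?thesis by (simp add: occurrences_def)
    qed
    then have "subst_freq \<zeta> s a w = (\<lambda>_. 0)" by (simp add: fun_eq_iff F)
    then show ?thesis by (simp add: \<nu>_def)
  qed
qed

text \<open>Two admissible powers \<open>s\<close> and \<open>s'\<close> share the subsequence of iterates \<open>s * s' * t\<close>.\<close>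

lemma limit_frequency_power_indep:
  assumes s: "1 \<le> s" "freqs_converge \<zeta> s a" and s': "1 \<le> s'" "freqs_converge \<zeta> s' a" and w: "w \<noteq> []"
  shows "lim (subst_freq \<zeta> s a w) = lim (subst_freq \<zeta> s' a w)"
proof -
  have sub: "(\<lambda>t. subst_freq \<zeta> s a w (s' * t)) \<longlonglongrightarrow> lim (subst_freq \<zeta> s a w)"
    if "1 \<le> s'" "freqs_converge \<zeta> s a" for s s'
  proof -
    have "subst_freq \<zeta> s a w \<longlonglongrightarrow> lim (subst_freq \<zeta> s a w)"
      using that w by (simp add: freqs_converge_def convergent_LIMSEQ_iff)
    moreover have "strict_mono (\<lambda>t. s' * t)"
      using that by (auto simp: strict_mono_def)
    ultimately show ?thesis using LIMSEQ_subseq_LIMSEQ by (fastforce simp: comp_def)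
  qed
  have "subst_freq \<zeta> s' a w (s * t) = subst_freq \<zeta> s a w (s' * t)" for t
    by (simp add: subst_freq_def mult.left_commute)
  then show ?thesis
    using sub[OF s'(1) s(2)] sub[OF s(1) s'(2)] by (simp add: LIMSEQ_unique)
qed

theorem corollary1p3:
  fixes \<zeta> :: "'a::finite \<Rightarrow> 'a list" and a :: 'a
  assumes "expanding \<zeta>"
  shows "(\<exists>s\<ge>1. \<forall>b. freqs_converge \<zeta> s b) \<and>
    (\<exists>!\<mu>. borel_measure_on (subshift_topology \<zeta>) \<mu> \<and>
          invariant_measure biinf_shift \<mu> \<and>
          (\<forall>s\<ge>1. freqs_converge \<zeta> s a \<longrightarrow>
             (\<forall>w. w \<noteq> [] \<longrightarrow>
                emeasure \<mu> (subst_cylinder \<zeta> w) = ennreal (lim (subst_freq \<zeta> s a w)))))"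
proof
  show powers: "\<exists>s\<ge>1. \<forall>b. freqs_converge \<zeta> s b"
    by (rule frequencies_converge_power[OF assms])
  then obtain s where s: "1 \<le> s" "freqs_converge \<zeta> s a" by blast
  let ?P = "\<lambda>\<mu>. borel_measure_on (subshift_topology \<zeta>) \<mu> \<and> invariant_measure biinf_shift \<mu> \<and>
    (\<forall>s\<ge>1. freqs_converge \<zeta> s a \<longrightarrow> (\<forall>w. w \<noteq> [] \<longrightarrow>
      emeasure \<mu> (subst_cylinder \<zeta> w) = ennreal (lim (subst_freq \<zeta> s a w))))"
  obtain \<mu> where \<mu>: "borel_measure_on (subshift_topology \<zeta>) \<mu>" "invariant_measure biinf_shift \<mu>"
    and cyl: "\<And>w. emeasure \<mu> (subst_cylinder \<zeta> w) = ennreal (lim (subst_freq \<zeta> s a w))"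
    using invariant_measure_of_weights[of "\<lambda>w. lim (subst_freq \<zeta> s a w)" \<zeta>]
      limit_frequencies_consistent[OF assms s] by blast
  show "\<exists>!\<mu>. ?P \<mu>"
  proof (rule ex1I[of _ \<mu>])
    show "?P \<mu>"
      using \<mu> cyl limit_frequency_power_indep[OF s] by simp
    fix \<mu>' assume \<mu>': "?P \<mu>'"
    then have "emeasure \<mu>' (window_cylinder \<zeta> i w) = ennreal (lim (subst_freq \<zeta> s a w))"
      if "w \<noteq> []" for i w
      using invariant_window_cylinder[of \<zeta> \<mu>' i w] s that by (simp add: subst_cylinder_def)
    moreover have "emeasure \<mu> (window_cylinder \<zeta> i w) = ennreal (lim (subst_freq \<zeta> s a w))" for i w
      using invariant_window_cylinder[OF \<mu>, of i w] cyl by (simp add: subst_cylinder_def)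
    ultimately show "\<mu>' = \<mu>"
      using \<mu> \<mu>' by (intro measure_eqI_window_cylinders) auto
  qed
qed

end
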